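(* For every integer $n \ge 2$, the derivational difference logic of Euclidean space $\mathbf{R}^n$ (with its standard topology) equals $\mathbf{DT_1CK}$, i.e. $\mathbf{Ld}_{\neq}(\mathbf{R}^n)=\mathbf{DT_1CK}$.
   Context: Formulas are built from countably many propositional variables using $\bot$, $\to$ and two unary modalities $\Box$ and $[\neq]$; $\neg,\wedge,\vee,\top$ are as usual, $\Diamond A:=\neg\Box\neg A$, $\langle\neq\rangle A:=\neg[\neq]\neg A$, and $\overline{\Box}A:=\Box A\wedge A$. A (normal bimodal) logic is a set of formulas containing all classical tautologies and the axioms $\Box(p\to q)\to(\Box p\to\Box q)$, $[\neq](p\to q)\to([\neq]p\to[\neq]q)$, and closed under modus ponens, necessitation for both modalities, and substitution; $L+\Gamma$ denotes the least logic containing $L\cup\Gamma$. $\mathbf{KT_1}$ is the least logic containing $\Box p\to\Box\Box p$, $p\wedge[\neq]p\to[\neq][\neq]p$, $\langle\neq\rangle[\neq]p\to p$, $[\neq]p\to\Box p$ and $[\neq]p\to[\neq]\Box p$. $\mathbf{DT_1}:=\mathbf{KT_1}+\Diamond\top$. Let $Ku:=\Box(\overline{\Box}p\vee\overline{\Box}\neg p)\to(\Box p\vee\Box\neg p)$ and $AC^{\sharp u}:=\big([\neq](\overline{\Box}p\vee\overline{\Box}\neg p)\wedge(\overline{\Box}p\vee\overline{\Box}\neg p)\big)\to\big(([\neq]p\wedge p)\vee([\neq]\neg p\wedge\neg p)\big)$. $\mathbf{DT_1CK}:=\mathbf{DT_1}+Ku+AC^{\sharp u}$. Topological (dd-)semantics: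 a valuation in a topological space $X$ assigns a subset of $X$ to each variable; truth at points is defined classically for Boolean connectives, $x\models\Box A$ iff there is an open $U\ni x$ with $y\models A$ for all $y\in U\setminus\{x\}$, and $x\models[\neq]A$ iff $y\models A$ for all $y\neq x$. $\mathbf{Ld}_{\neq}(X)$ is the set of formulas true at all points of $X$ under all valuations. *)

theory Defs
  imports "HOL-Analysis.Analysis"
begin

section \<open>Bimodal formulas\<close>

datatype fm =
    Var nat
  | Bot                (\<open>\<^bold>\<bottom>\<close>)
  | Imp fm fm          (infixr \<open>\<^bold>\<rightarrow>\<close> 55)
  | Box fm             (\<open>\<box> _\<close> [70] 70)
  | DBox fm            (\<open>[\<noteq>] _\<close> [70] 70)

abbreviation Neg :: "fm \<Rightarrow> fm" (\<open>\<^bold>\<not> _\<close> [70] 70)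
  where "\<^bold>\<not> A \<equiv> A \<^bold>\<rightarrow> \<^bold>\<bottom>"

abbreviation Top :: fm (\<open>\<^bold>\<top>\<close>)
  where "\<^bold>\<top> \<equiv> \<^bold>\<not> \<^bold>\<bottom>"

abbreviation Or :: "fm \<Rightarrow> fm \<Rightarrow> fm" (infixr \<open>\<^bold>\<or>\<close> 60)
  where "A \<^bold>\<or> B \<equiv> \<^bold>\<not> A \<^bold>\<rightarrow> B"

abbreviation And :: "fm \<Rightarrow> fm \<Rightarrow> fm" (infixr \<open>\<^bold>\<and>\<close> 65)
  where "A \<^bold>\<and> B \<equiv> \<^bold>\<not> (A \<^bold>\<rightarrow> \<^bold>\<not> B)"

abbreviation Dia :: "fm \<Rightarrow> fm" (\<open>\<diamond> _\<close> [70] 70)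
  where "\<diamond> A \<equiv> \<^bold>\<not> \<box> \<^bold>\<not> A"

abbreviation DDia :: "fm \<Rightarrow> fm" (\<open>\<langle>\<noteq>\<rangle> _\<close> [70] 70)
  where "\<langle>\<noteq>\<rangle> A \<equiv> \<^bold>\<not> [\<noteq>] \<^bold>\<not> A"

abbreviation RBox :: "fm \<Rightarrow> fm" (\<open>\<^bold>\<box> _\<close> [70] 70)
  where "\<^bold>\<box> A \<equiv> \<box> A \<^bold>\<and> A"

primrec subst :: "(nat \<Rightarrow> fm) \<Rightarrow> fm \<Rightarrow> fm" where
  "subst s (Var i) = s i"
| "subst s \<^bold>\<bottom> = \<^bold>\<bottom>"
| "subst s (A \<^bold>\<rightarrow> B) = subst s A \<^bold>\<rightarrow> subst s B"
| "subst s (\<box> A) = \<box> subst s A"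
| "subst s ([\<noteq>] A) = [\<noteq>] subst s A"


section \<open>Normal bimodal logics\<close>

text \<open>Formulas beginning with a modality count as atoms here, so that substitution
  instances of purely propositional tautologies are tautologies as well.\<close>

definition tautology :: "fm \<Rightarrow> bool" where
  "tautology A \<longleftrightarrow>
     (\<forall>v :: fm \<Rightarrow> bool.
        \<not> v \<^bold>\<bottom> \<and> (\<forall>B C. v (B \<^bold>\<rightarrow> C) \<longleftrightarrow> (v B \<longrightarrow> v C)) \<longrightarrow> v A)"

text \<open>Axioms are single formulas in fixed distinct variables; their instances come from
  closure under substitution.\<close>

abbreviation p :: fm where "p \<equiv> Var 0"
abbreviation q :: fm where "q \<equiv> Var 1"

definition normal_logic :: "fm set \<Rightarrow> bool" where
  "normal_logic L \<longleftrightarrow>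
     {A. tautology A} \<subseteq> L \<and>
     \<box> (p \<^bold>\<rightarrow> q) \<^bold>\<rightarrow> (\<box> p \<^bold>\<rightarrow> \<box> q) \<in> L \<and>
     [\<noteq>] (p \<^bold>\<rightarrow> q) \<^bold>\<rightarrow> ([\<noteq>] p \<^bold>\<rightarrow> [\<noteq>] q) \<in> L \<and>
     (\<forall>A B. A \<^bold>\<rightarrow> B \<in> L \<longrightarrow> A \<in> L \<longrightarrow> B \<in> L) \<and>
     (\<forall>A \<in> L. \<box> A \<in> L) \<and>
     (\<forall>A \<in> L. [\<noteq>] A \<in> L) \<and>
     (\<forall>A \<in> L. \<forall>s. subst s A \<in> L)"

definition least_logic :: "fm set \<Rightarrow> fm set" where
  "least_logic \<Gamma> = \<Inter> {L. normal_logic L \<and> \<Gamma> \<subseteq> L}"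

lemma normal_logic_least_logic: "normal_logic (least_logic \<Gamma>)"
  unfolding least_logic_def normal_logic_def by blast

lemma least_logic_superset: "\<Gamma> \<subseteq> least_logic \<Gamma>"
  unfolding least_logic_def by blast

lemma least_logic_least: "normal_logic L \<Longrightarrow> \<Gamma> \<subseteq> L \<Longrightarrow> least_logic \<Gamma> \<subseteq> L"
  unfolding least_logic_def by blast

definition ext_logic :: "fm set \<Rightarrow> fm set \<Rightarrow> fm set" (infixl \<open>\<^bold>+\<close> 65) where
  "L \<^bold>+ \<Gamma> = least_logic (L \<union> \<Gamma>)"

definition KT1 :: "fm set" where
  "KT1 = least_logic
     {\<box> p \<^bold>\<rightarrow> \<box> \<box> p,
      p \<^bold>\<and> [\<noteq>] p \<^bold>\<rightarrow> [\<noteq>] [\<noteq>] p,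
      \<langle>\<noteq>\<rangle> [\<noteq>] p \<^bold>\<rightarrow> p,
      [\<noteq>] p \<^bold>\<rightarrow> \<box> p,
      [\<noteq>] p \<^bold>\<rightarrow> [\<noteq>] \<box> p}"

definition DT1 :: "fm set" where
  "DT1 = KT1 \<^bold>+ {\<diamond> \<^bold>\<top>}"

definition Ku :: fm where
  "Ku = \<box> (\<^bold>\<box> p \<^bold>\<or> \<^bold>\<box> \<^bold>\<not> p) \<^bold>\<rightarrow> (\<box> p \<^bold>\<or> \<box> \<^bold>\<not> p)"

definition AC_sharp_u :: fm where
  "AC_sharp_u =
     [\<noteq>] (\<^bold>\<box> p \<^bold>\<or> \<^bold>\<box> \<^bold>\<not> p) \<^bold>\<and> (\<^bold>\<box> p \<^bold>\<or> \<^bold>\<box> \<^bold>\<not> p) \<^bold>\<rightarrow>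
     ([\<noteq>] p \<^bold>\<and> p) \<^bold>\<or> ([\<noteq>] \<^bold>\<not> p \<^bold>\<and> \<^bold>\<not> p)"

definition DT1CK :: "fm set" where
  "DT1CK = DT1 \<^bold>+ {Ku, AC_sharp_u}"


section \<open>Topological semantics\<close>

primrec dd_sat :: "'a topology \<Rightarrow> (nat \<Rightarrow> 'a set) \<Rightarrow> 'a \<Rightarrow> fm \<Rightarrow> bool" where
  "dd_sat X V x (Var i) \<longleftrightarrow> x \<in> V i"
| "dd_sat X V x \<^bold>\<bottom> \<longleftrightarrow> False"
| "dd_sat X V x (A \<^bold>\<rightarrow> B) \<longleftrightarrow> (dd_sat X V x A \<longrightarrow> dd_sat X V x B)"
| "dd_sat X V x (\<box> A) \<longleftrightarrow> (\<exists>U. openin X U \<and> x \<in> U \<and> (\<forall>y \<in> U - {x}. dd_sat X V y A))"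
| "dd_sat X V x ([\<noteq>] A) \<longleftrightarrow> (\<forall>y \<in> topspace X - {x}. dd_sat X V y A)"

definition Ld_neq :: "'a topology \<Rightarrow> fm set" where
  "Ld_neq X =
     {A. \<forall>V. (\<forall>i. V i \<subseteq> topspace X) \<longrightarrow> (\<forall>x \<in> topspace X. dd_sat X V x A)}"

hide_const (open) p q

end

theory Submission
  imports Defs
begin

text \<open>Soundness holds because \<open>\<real>\<^sup>n\<close> and its punctured balls are connected. For completeness, the
  submodel of the canonical model generated by a point refuting \<open>\<phi>\<close> is filtrated to a finite
  transitive serial frame in which the whole frame and all cones are connected and a set of points
  without predecessors has to be realised exactly once. Such a frame is the image of
  \<open>\<real>\<^sup>n\<close> under a map for which the values taken near a point \<open>x\<close>, except at \<open>x\<close>, are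
  precisely the successors of the value at \<open>x\<close>. A reflexive point is realised on a Sierpinski carpet whose
  holes carry its strict successors, an irreflexive one at the centre of a sequence of shrinking
  shells; regions of different colours are glued along spheres, following paths of comparable
  reflexive points.\<close>

section \<open>Colourings of Euclidean space\<close>

text \<open>Two obstacles shape the construction. The cone of a filtration class is built from the
  cones of different points; \<open>Ku\<close> connects each of these, but their union need not be
  connected. Classes therefore record, besides the subformulas of \<open>\<phi>\<close>, which sets
  of types can confine a whole cone (\<open>E\<close>), and this makes any two members of a class
  see a common class. The second obstacle is \<open>[\<noteq>]\<close>: in the canonical model it is
  inequality plus possibly some reflexive points, and a class consisting of one point not related to
  itself must be hit by exactly one point of the space. Hence chosen values are prescribed at chosen
  points, and everything around them is painted with values that have predecessors. Pieces of
  different colours meet along spheres. A sphere has a single colour, which must therefore be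
  reflexive and must see what is shown on both of its sides. This is why paths run through
  comparable reflexive points, while an irreflexive value can occur only at isolated points.\<close>

definition sees :: "'w rel \<Rightarrow> ('a \<Rightarrow> 'w) \<Rightarrow> 'a filter \<Rightarrow> 'w \<Rightarrow> bool" where
  "sees R g F w \<longleftrightarrow>
     (\<forall>\<^sub>F y in F. (w, g y) \<in> R) \<and> (\<forall>u. (w, u) \<in> R \<longrightarrow> (\<exists>\<^sub>F y in F. g y = u))"

text \<open>The label \<open>w\<close> belongs to the outside: it need not be a value of
  \<open>g\<close>, but a frontier point looking into \<open>G\<close> sees exactly the successors
  of \<open>w\<close>. Pieces can thus be glued knowing only their labels.\<close>

definition fills :: "'w rel \<Rightarrow> 'w \<Rightarrow> 'a::topological_space set \<Rightarrow> ('a \<Rightarrow> 'w) \<Rightarrow> bool" where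
  "fills R w G g \<longleftrightarrow>
     (\<forall>x\<in>G. sees R g (at x) (g x)) \<and> (\<forall>x\<in>frontier G. sees R g (at x within G) w)"

lemma sees_cong:
  assumes "\<forall>\<^sub>F y in F. g y = h y"
  shows "sees R g F w \<longleftrightarrow> sees R h F w"
proof -
  have "(\<forall>\<^sub>F y in F. (w, g y) \<in> R) \<longleftrightarrow> (\<forall>\<^sub>F y in F. (w, h y) \<in> R)"
    by (rule eventually_cong[OF assms]) simp
  moreover have "(\<exists>\<^sub>F y in F. g y = u) \<longleftrightarrow> (\<exists>\<^sub>F y in F. h y = u)" for u
    by (rule frequently_cong[OF assms]) simp
  ultimately show ?thesis by (simp add: sees_def)
qed

lemma frequently_sup_left: "frequently P F \<Longrightarrow> frequently P (sup F G)"
  by (simp add: frequently_def eventually_sup)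

lemma sees_sup:
  assumes "sees R g F w" "\<forall>\<^sub>F y in G. (w, g y) \<in> R"
  shows "sees R g (sup F G) w"
  using assms by (auto simp: sees_def eventually_sup intro: frequently_sup_left)

lemma fills_cong_imp:
  assumes "fills R w U g" "open U" "\<And>x. x \<in> U \<Longrightarrow> h x = g x"
  shows "fills R w U h"
proof -
  have "sees R h (at x) (h x)" if "x \<in> U" for x
  proof -
    have "\<forall>\<^sub>F y in at x. g y = h y"
      using that assms(2,3) by (auto simp: eventually_at_topological)
    then have "sees R g (at x) (g x) \<longleftrightarrow> sees R h (at x) (g x)" by (rule sees_cong)
    then show ?thesis using assms that by (simp add: fills_def)
  qed
  moreover have "sees R h (at x within U) w" if "x \<in> frontier U" for x
  proof -
    have "\<forall>\<^sub>F y in at x within U. g y = h y"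
      using assms(3) by (auto simp: eventually_at_topological)
    then have "sees R g (at x within U) w \<longleftrightarrow> sees R h (at x within U) w" by (rule sees_cong)
    then show ?thesis using assms that by (simp add: fills_def)
  qed
  ultimately show ?thesis by (auto simp: fills_def)
qed

section \<open>Gluing two pieces along a sphere\<close>

text \<open>The filter at a sphere point splits into outside, inside and the sphere itself. The side
  labelled \<open>s\<close> already shows all successors of \<open>s\<close>; by transitivity the
  other side shows nothing else, nor does the sphere, because \<open>s\<close> is reflexive. The
  radius \<open>r'\<close> lets the inner piece be a shell.\<close>

lemma sees_sphere:
  fixes c :: "'a::euclidean_space"
  assumes "trans R" "open B" "cball c r \<subseteq> B" "0 < r" "r' < r"
    and f1: "fills R w1 (B - cball c r) g"
    and f2: "fills R w2 (ball c r - cball c r') g"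
    and s: "s = w1 \<and> (w1, w2) \<in> R \<or> s = w2 \<and> (w2, w1) \<in> R"
    and ss: "(s, s) \<in> R" and g: "\<And>x. x \<in> sphere c r \<Longrightarrow> g x = s"
    and x: "x \<in> sphere c r"
  shows "sees R g (at x) (g x)"
proof -
  let ?U = "B - cball c r" and ?V = "ball c r - cball c r'" and ?K = "sphere c r"
  have opn: "open ?U" "open ?V" using assms by auto
  have "x \<in> B \<inter> closure (- cball c r)"
    using x assms(3) by (auto simp: closure_complement)
  then have "x \<in> closure ?U"
    using open_Int_closure_subset[OF \<open>open B\<close>, of "- cball c r"] by (auto simp: Diff_eq)
  then have xU: "x \<in> frontier ?U" using x opn by (simp add: frontier_def interior_open)
  have "x \<in> (- cball c r') \<inter> closure (ball c r)"
    using x assms(4,5) by simp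
  then have "x \<in> closure ?V"
    using open_Int_closure_subset[of "- cball c r'" "ball c r"]
    by (auto simp: Diff_eq Int_commute open_Compl)
  then have xV: "x \<in> frontier ?V" using x opn by (simp add: frontier_def interior_open)
  have eq: "at x = sup (sup (at x within ?U) (at x within ?V)) (at x within ?K)"
  proof -
    have "?U \<union> ?V \<union> ?K = B - cball c r'" using assms(3,4,5) by auto
    moreover have "open (B - cball c r')" "x \<in> B - cball c r'" using assms x by auto
    ultimately show ?thesis by (metis at_within_open at_within_union)
  qed
  have s1: "sees R g (at x within ?U) w1" and s2: "sees R g (at x within ?V) w2"
    using f1 f2 xU xV by (auto simp: fills_def)
  have K: "\<forall>\<^sub>F y in at x within ?K. (s, g y) \<in> R"
    using g ss by (auto simp: eventually_at_topological)
  have "sees R g (sup (at x within ?U) (at x within ?V)) s"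
    using s
  proof
    assume a: "s = w1 \<and> (w1, w2) \<in> R"
    have "\<forall>\<^sub>F y in at x within ?V. (w1, g y) \<in> R"
      using s2 a \<open>trans R\<close> unfolding sees_def by (auto elim!: eventually_mono dest: transD)
    then show ?thesis using s1 a by (auto intro: sees_sup)
  next
    assume a: "s = w2 \<and> (w2, w1) \<in> R"
    have "\<forall>\<^sub>F y in at x within ?U. (w2, g y) \<in> R"
      using s1 a \<open>trans R\<close> unfolding sees_def by (auto elim!: eventually_mono dest: transD)
    then have "sees R g (sup (at x within ?V) (at x within ?U)) w2"
      using s2 by (intro sees_sup)
    then show ?thesis using a by (simp add: sup_commute)
  qed
  then show ?thesis using g[OF x] by (simp add: eq sees_sup[OF _ K])
qed

text \<open>The deleted ball is closed and lies inside \<open>G\<close>, so it keeps away from the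
  frontier points of \<open>G\<close>.\<close>

lemma fills_outer:
  fixes c :: "'a::euclidean_space"
  assumes "fills R w (G - cball c r) g" "open G" "cball c r \<subseteq> G" "x \<in> frontier G"
  shows "sees R g (at x within G) w"
proof -
  have xG: "x \<notin> G" "x \<in> closure G" using assms by (auto simp: frontier_def interior_open)
  have x: "x \<in> - cball c r" using xG assms(3) by auto
  have "at x within G = at x within (G - cball c r)"
    by (rule at_within_nhd[OF x]) auto
  moreover have "x \<in> closure (G - cball c r)"
    using open_Int_closure_subset[of "- cball c r" G] x xG
    by (auto simp: Diff_eq Int_commute open_Compl)
  then have "x \<in> frontier (G - cball c r)"
    using xG assms(2) by (simp add: frontier_def interior_open open_Diff)
  ultimately show ?thesis using assms(1) by (simp add: fills_def)
qed

lemma fills_glue: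
  fixes c :: "'a::euclidean_space"
  assumes "trans R" "open G" "cball c r \<subseteq> G" "0 < r"
    and f1: "fills R w1 (G - cball c r) g1"
    and f2: "fills R w2 (ball c r) g2"
    and s: "s = w1 \<and> (w1, w2) \<in> R \<or> s = w2 \<and> (w2, w1) \<in> R"
    and ss: "(s, s) \<in> R"
  shows "fills R w1 G (\<lambda>x. if x \<in> ball c r then g2 x else if x \<in> sphere c r then s else g1 x)"
    (is "fills R w1 G ?g")
proof -
  have h1: "fills R w1 (G - cball c r) ?g"
    by (rule fills_cong_imp[OF f1]) (use assms in auto)
  have h2: "fills R w2 (ball c r) ?g"
    by (rule fills_cong_imp[OF f2]) auto
  \<comment> \<open>Radius \<open>- 1\<close> makes the inner \<open>cball\<close> empty, so the
    full ball passes as a shell.\<close>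
  then have h2': "fills R w2 (ball c r - cball c (- 1)) ?g" by simp
  have "sees R ?g (at x) (?g x)" if xG: "x \<in> G" for x
  proof -
    consider "x \<in> G - cball c r" | "x \<in> ball c r" | "x \<in> sphere c r"
      using xG by force
    then show ?thesis
    proof cases
      case 1 then show ?thesis using h1 unfolding fills_def by blast
    next
      case 2 then show ?thesis using h2 unfolding fills_def by blast
    next
      case 3
      show ?thesis
        by (rule sees_sphere[OF assms(1-4) _ h1 h2' s ss _ 3]) (use assms(4) in auto)
    qed
  qed
  then show ?thesis using fills_outer[OF h1 assms(2,3)] by (auto simp: fills_def)
qed

section \<open>Finite frames and dense families\<close>

text \<open>For \<open>S\<close> closed under successors this is connectedness in the topology whose
  open sets are the up-sets.\<close>

definition rconn :: "'w rel \<Rightarrow> 'w set \<Rightarrow> bool" where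
  "rconn R S \<longleftrightarrow>
     (\<forall>A\<subseteq>S. A \<noteq> {} \<longrightarrow> R `` A \<subseteq> A \<longrightarrow> R `` (S - A) \<subseteq> S - A \<longrightarrow> A = S)"

definition rcomp :: "'w rel \<Rightarrow> 'w set \<Rightarrow> 'w rel" where
  "rcomp R S =
     {(v, w). v \<in> S \<and> w \<in> S \<and> (v, v) \<in> R \<and> (w, w) \<in> R \<and> ((v, w) \<in> R \<or> (w, v) \<in> R)}"

locale kframe =
  fixes W :: "'w set" and R :: "'w rel"
  assumes fin: "finite W"
    and sub: "R \<subseteq> W \<times> W"
    and tr: "trans R"
    and serial: "w \<in> W \<Longrightarrow> R `` {w} \<noteq> {}"
    and conn: "w \<in> W \<Longrightarrow> rconn R (R `` {w})"
begin

lemma Image_sub: "R `` {w} \<subseteq> W"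
  using sub by auto

lemma Image_mono: "(w, u) \<in> R \<Longrightarrow> R `` {u} \<subseteq> R `` {w}"
  using tr by (auto dest: transD)

lemma finite_Image: "finite (R `` {w})"
  using Image_sub fin finite_subset by blast

text \<open>Take a successor \<open>t\<close> with the smallest cone. By minimality a successor of
  \<open>t\<close> has the same cone as \<open>t\<close>, hence lies in its own cone.\<close>

lemma ex_reflexive:
  assumes "s \<in> W"
  shows "\<exists>v. (s, v) \<in> R \<and> (v, v) \<in> R"
proof -
  obtain t where t: "t \<in> R `` {s}" "\<And>u. u \<in> R `` {s} \<Longrightarrow> card (R `` {t}) \<le> card (R `` {u})"
    using arg_min_if_finite(1)[OF finite_Image serial[OF assms], of "\<lambda>t. card (R `` {t})"]
      arg_min_least[OF finite_Image serial[OF assms], of _ "\<lambda>t. card (R `` {t})"] by blast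
  have "t \<in> W" using t Image_sub by blast
  then obtain v where v: "(t, v) \<in> R" using serial by blast
  then have "v \<in> R `` {s}" using t tr by (auto dest: transD)
  then have "card (R `` {t}) \<le> card (R `` {v})" using t by blast
  then have "R `` {v} = R `` {t}"
    using Image_mono[OF v] finite_Image by (metis card_seteq)
  then show ?thesis using v \<open>v \<in> R `` {s}\<close> by blast
qed

text \<open>An irreflexive point on a connecting path can be bypassed inside its own cone, which is
  connected and smaller.\<close>

lemma reflexive_path:
  assumes "S \<subseteq> W" "R `` S \<subseteq> S" "rconn R S" "v \<in> S" "(v, v) \<in> R" "w \<in> S" "(w, w) \<in> R"
  shows "(v, w) \<in> (rcomp R S)\<^sup>*"
proof -
  have "finite S" using assms fin finite_subset by blast
  then show ?thesis using assms
  proof (induction S arbitrary: v w rule: finite_psubset_induct)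
    case (psubset S)
    define C where "C = {u. (v, u) \<in> (rcomp R S)\<^sup>*}"
    \<comment> \<open>\<open>C\<close> is the component of \<open>v\<close> among reflexive points.
      \<open>A\<close> extends it to irreflexive points through the reflexive points above them, so
      that connectedness of \<open>S\<close>, which concerns all points, can be applied.\<close>
    define A where "A = {s \<in> S. \<forall>u\<in>insert s (R `` {s}). (u, u) \<in> R \<longrightarrow> u \<in> C}"
    have S: "\<And>s t. s \<in> S \<Longrightarrow> (s, t) \<in> R \<Longrightarrow> t \<in> S" using psubset.prems(2) by blast
    have C: "u \<in> C" if "t \<in> C" "(t, u) \<in> rcomp R S" for t u
      using that by (auto simp: C_def)
    have "v \<in> C" by (simp add: C_def)
    then have "v \<in> A"
      using psubset.prems(4,5) S C by (auto simp: A_def rcomp_def)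
    moreover have "R `` A \<subseteq> A"
      using S tr by (auto simp: A_def dest: transD)
    moreover have "R `` (S - A) \<subseteq> S - A"
    proof
      fix t assume "t \<in> R `` (S - A)"
      then obtain s where s: "s \<in> S" "s \<notin> A" "(s, t) \<in> R" by blast
      then have "t \<in> S" using S by blast
      have "t \<notin> A"
      proof
        assume "t \<in> A"
        obtain u0 where u0: "(t, u0) \<in> R" "(u0, u0) \<in> R"
          using ex_reflexive \<open>t \<in> S\<close> psubset.prems(1) by blast
        then have u0C: "u0 \<in> C" using \<open>t \<in> A\<close> by (auto simp: A_def)
        have su0: "(s, u0) \<in> R" using u0 s tr by (auto dest: transD)
        have "u \<in> C" if u: "u \<in> insert s (R `` {s})" "(u, u) \<in> R" for u
        proof (cases "(s, s) \<in> R")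
          case True
          then have "(u0, s) \<in> rcomp R S" "(s, u) \<in> rcomp R S"
            using u u0 su0 S s by (auto simp: rcomp_def)
          then show ?thesis using u0C C by blast
        next
          case False
          then have us: "u \<in> R `` {s}" using u by auto
          have "R `` {s} \<subset> S" using False s S by blast
          moreover have "R `` R `` {s} \<subseteq> R `` {s}" using tr by (auto dest: transD)
          moreover have "rconn R (R `` {s})" using conn s psubset.prems(1) by blast
          ultimately have "(u0, u) \<in> (rcomp R (R `` {s}))\<^sup>*"
            using psubset.IH[of "R `` {s}" u0 u] Image_sub us su0 u0 u by blast
          moreover have "rcomp R (R `` {s}) \<subseteq> rcomp R S"
            using S s by (auto simp: rcomp_def)
          ultimately have "(u0, u) \<in> (rcomp R S)\<^sup>*" using rtrancl_mono by blast
          then show ?thesis using u0C by (simp add: C_def)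
        qed
        then have "s \<in> A" using s by (simp add: A_def)
        then show False using s by blast
      qed
      then show "t \<in> S - A" using \<open>t \<in> S\<close> by blast
    qed
    moreover have "A \<subseteq> S" by (auto simp: A_def)
    ultimately have "A = S" using psubset.prems(3) unfolding rconn_def by blast
    then have "w \<in> A" using psubset.prems by blast
    then show ?case using psubset.prems by (auto simp: A_def C_def)
  qed
qed

end

section \<open>Dense colourings and dense families of balls\<close>

lemma choose_sequence:
  assumes "\<And>n X. finite X \<Longrightarrow> \<exists>y. P n X y"
  shows "\<exists>f :: nat \<Rightarrow> 'b. \<forall>n. P n (f ` {..<n}) (f n)"
proof -
  define G where "G = rec_nat [] (\<lambda>n xs. xs @ [SOME y. P n (set xs) y])"
  define f where "f n = (SOME y. P n (set (G n)) y)" for n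
  have "set (G n) = f ` {..<n}" for n
    by (induction n) (auto simp: G_def f_def lessThan_Suc)
  moreover have "P n (set (G n)) (f n)" for n
    unfolding f_def using assms[of "set (G n)" n] by (metis List.finite_set someI_ex)
  ultimately show ?thesis by metis
qed

text \<open>Enumerating pairs of a basic set and a label turns the density of all labels into one
  requirement per natural number, which the constructions below meet one after the other.\<close>

lemma labelled_basis:
  assumes "countable L" "L \<noteq> {}"
  obtains B :: "nat \<Rightarrow> 'a::second_countable_topology set" and l :: "nat \<Rightarrow> 'l"
  where "\<And>n. open (B n)" "\<And>n. B n \<noteq> {}" "\<And>n. l n \<in> L"
    "\<And>U x a. open U \<Longrightarrow> x \<in> U \<Longrightarrow> a \<in> L \<Longrightarrow> \<exists>n. x \<in> B n \<and> B n \<subseteq> U \<and> l n = a"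
proof -
  obtain \<B> :: "'a set set" where \<B>: "countable \<B>" "topological_basis \<B>"
    using ex_countable_basis by blast
  define Q where "Q = (\<B> - {{}}) \<times> L"
  have basis: "\<exists>V\<in>\<B>. x \<in> V \<and> V \<subseteq> U" if "open U" "x \<in> U" for U x
    using \<B>(2) that topological_basisE by metis
  have "Q \<noteq> {}" using basis[of UNIV undefined] assms by (auto simp: Q_def)
  moreover have "countable Q" using \<B> assms by (simp add: Q_def)
  ultimately have Q: "range (from_nat_into Q) = Q" by simp
  show thesis
  proof
    fix n
    have "from_nat_into Q n \<in> Q" using Q by blast
    then show "open (fst (from_nat_into Q n))" "fst (from_nat_into Q n) \<noteq> {}"
      "snd (from_nat_into Q n) \<in> L"
      using topological_basis_open[OF \<B>(2)] by (auto simp: Q_def)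
  next
    fix U :: "'a set" and x a assume "open U" "x \<in> U" "a \<in> L"
    then obtain V where V: "V \<in> \<B>" "x \<in> V" "V \<subseteq> U" using basis by blast
    then have "(V, a) \<in> Q" using \<open>a \<in> L\<close> by (auto simp: Q_def)
    then obtain n where "from_nat_into Q n = (V, a)" using Q by (metis imageE)
    then show "\<exists>n. x \<in> fst (from_nat_into Q n) \<and> fst (from_nat_into Q n) \<subseteq> U \<and>
        snd (from_nat_into Q n) = a"
      using V by (intro exI[of _ n]) simp
  qed
qed

text \<open>Pick pairwise distinct points, the n-th one in the n-th labelled basic set; there is
  always a fresh one because nonempty open sets of a perfect T1 space are infinite.\<close>

lemma dense_colouring:
  assumes "countable L" "L \<noteq> {}"
  shows "\<exists>e :: 'a::{second_countable_topology, perfect_space, t1_space} \<Rightarrow> 'l. range e \<subseteq> L \<and>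
    (\<forall>a\<in>L. \<forall>U. open U \<longrightarrow> U \<noteq> {} \<longrightarrow> (\<exists>y\<in>U. e y = a))"
proof -
  obtain B :: "nat \<Rightarrow> 'a set" and l where B: "\<And>n. open (B n)" "\<And>n. B n \<noteq> {}" "\<And>n. l n \<in> L"
    "\<And>U x a. open U \<Longrightarrow> x \<in> U \<Longrightarrow> a \<in> L \<Longrightarrow> \<exists>n. x \<in> B n \<and> B n \<subseteq> U \<and> l n = a"
    using labelled_basis[OF assms] by metis
  have "\<exists>y. y \<in> B n \<and> y \<notin> X" if X: "finite X" for n X
  proof -
    obtain z where "z \<in> B n" using B by blast
    then have "infinite (B n)" using B(1)[of n]
      by (metis islimpt_UNIV Int_UNIV_right islimpt_eq_acc_point)
    then show ?thesis using X by (meson finite_subset subsetI)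
  qed
  from choose_sequence[of "\<lambda>n X y. y \<in> B n \<and> y \<notin> X", OF this]
  obtain f :: "nat \<Rightarrow> 'a" where f: "\<And>n. f n \<in> B n" "\<And>n. f n \<notin> f ` {..<n}" by blast
  have inj: "n = m" if "f n = f m" for n m
    using f(2)[of n] f(2)[of m] that by (metis imageI lessThan_iff linorder_neqE_nat)
  obtain a0 where a0: "a0 \<in> L" using assms by blast
  define e where "e y = (if y \<in> range f then l (inv f y) else a0)" for y
  have e: "e (f n) = l n" for n
    using inj by (simp add: e_def inv_f_f injI)
  have "range e \<subseteq> L" using B(3) a0 by (auto simp: e_def)
  moreover have "\<exists>y\<in>U. e y = a" if U: "a \<in> L" "open U" "U \<noteq> {}" for a U
  proof -
    obtain n where "B n \<subseteq> U" "l n = a" using B(4)[OF U(2) _ U(1)] U(3) by blast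
    then show ?thesis using f(1)[of n] e[of n] by blast
  qed
  ultimately show ?thesis by blast
qed

text \<open>A Sierpinski carpet, built greedily: stage \<open>n\<close> takes a closed ball inside
  \<open>B n\<close> and \<open>G\<close> that avoids the balls taken before, if there is one.
  Density is claimed at every point left over, boundary spheres and frontier of \<open>G\<close>
  included.\<close>

lemma dense_ball_family:
  fixes G :: "'a::euclidean_space set"
  assumes "open G" "countable L" "L \<noteq> {}"
  obtains I :: "nat set" and c :: "nat \<Rightarrow> 'a" and r :: "nat \<Rightarrow> real" and l :: "nat \<Rightarrow> 'l"
  where "\<And>i. i \<in> I \<Longrightarrow> 0 < r i" "\<And>i. i \<in> I \<Longrightarrow> cball (c i) (r i) \<subseteq> G" "\<And>i. l i \<in> L"
    "\<And>i j. i \<in> I \<Longrightarrow> j \<in> I \<Longrightarrow> i \<noteq> j \<Longrightarrow> cball (c i) (r i) \<inter> cball (c j) (r j) = {}"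
    "\<And>U x a. open U \<Longrightarrow> x \<in> U \<Longrightarrow> x \<in> closure G \<Longrightarrow> x \<notin> (\<Union>i\<in>I. ball (c i) (r i)) \<Longrightarrow>
       a \<in> L \<Longrightarrow> \<exists>i\<in>I. l i = a \<and> cball (c i) (r i) \<subseteq> U"
proof -
  obtain B :: "nat \<Rightarrow> 'a set" and l where B: "\<And>n. open (B n)" "\<And>n. B n \<noteq> {}" "\<And>n. l n \<in> L"
    "\<And>U x a. open U \<Longrightarrow> x \<in> U \<Longrightarrow> a \<in> L \<Longrightarrow> \<exists>n. x \<in> B n \<and> B n \<subseteq> U \<and> l n = a"
    using labelled_basis[OF assms(2,3)] by metis
  define ok where "ok n X b \<longleftrightarrow> 0 < snd b \<and> cball (fst b) (snd b) \<subseteq> B n \<inter> G \<and>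
      (\<forall>b'. Some b' \<in> X \<longrightarrow> cball (fst b) (snd b) \<inter> cball (fst b') (snd b') = {})"
    for n and X :: "('a \<times> real) option set" and b
  \<comment> \<open>\<open>None\<close> marks the stages at which no ball fits.\<close>
  have "\<exists>y. (case y of None \<Rightarrow> \<not> (\<exists>b. ok n X b) | Some b \<Rightarrow> ok n X b)" for n X
  proof (cases "\<exists>b. ok n X b")
    case True
    then obtain b where "ok n X b" by blast
    then show ?thesis by (intro exI[of _ "Some b"]) simp
  next
    case False
    then show ?thesis by (intro exI[of _ None]) simp
  qed
  from choose_sequence[of "\<lambda>n X y. (case y of None \<Rightarrow> \<not> (\<exists>b. ok n X b) | Some b \<Rightarrow> ok n X b)", OF this]
  obtain f where f: "\<And>n. (case f n of None \<Rightarrow> \<not> (\<exists>b. ok n (f ` {..<n}) b)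
      | Some b \<Rightarrow> ok n (f ` {..<n}) b)"
    by blast
  define I where "I = {n. f n \<noteq> None}"
  define c where "c n = fst (the (f n))" for n
  define r where "r n = snd (the (f n))" for n
  have fI: "f i = Some (c i, r i)" if "i \<in> I" for i
    using that by (auto simp: I_def c_def r_def)
  have okI: "ok i (f ` {..<i}) (c i, r i)" if "i \<in> I" for i
    using f[of i] fI[OF that] by simp
  have pos: "0 < r i" and inB: "cball (c i) (r i) \<subseteq> B i" and inG: "cball (c i) (r i) \<subseteq> G"
    if "i \<in> I" for i
    using okI[OF that] by (auto simp: ok_def)
  have less: "cball (c i) (r i) \<inter> cball (c j) (r j) = {}" if "i \<in> I" "j \<in> I" "j < i" for i j
  proof -
    have "Some (c j, r j) \<in> f ` {..<i}" using that fI[OF \<open>j \<in> I\<close>] by (metis imageI lessThan_iff)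
    then show ?thesis using okI[OF \<open>i \<in> I\<close>] by (simp add: ok_def)
  qed
  have disj: "cball (c i) (r i) \<inter> cball (c j) (r j) = {}" if "i \<in> I" "j \<in> I" "i \<noteq> j" for i j
    using less[of i j] less[of j i] that by (metis Int_commute linorder_neqE_nat)
  have dense: "\<exists>i\<in>I. l i = a \<and> cball (c i) (r i) \<subseteq> U"
    if U: "open U" "x \<in> U" and x: "x \<in> closure G" "x \<notin> (\<Union>i\<in>I. ball (c i) (r i))" and a: "a \<in> L"
    for U x a
  proof -
    obtain n where n: "x \<in> B n" "B n \<subseteq> U" "l n = a" using B(4) U a by blast
    define J where "J = I \<inter> {..<n}"
    have finJ: "finite J" by (simp add: J_def)
    have "B n \<inter> G - (\<Union>i\<in>J. cball (c i) (r i)) \<noteq> {}"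
    \<comment> \<open>The closed balls are disjoint, so \<open>x\<close> lies on at most one sphere.
      Near \<open>x\<close> only that ball takes away room, and its complement accumulates at
      \<open>x\<close>.\<close>
    proof (cases "\<exists>j\<in>J. x \<in> cball (c j) (r j)")
      case True
      then obtain j where j: "j \<in> J" "x \<in> cball (c j) (r j)" by blast
      then have jI: "j \<in> I" by (simp add: J_def)
      have xs: "x \<notin> ball (c j) (r j)" using x jI by blast
      define N where "N = B n \<inter> G - (\<Union>i\<in>J - {j}. cball (c i) (r i))"
      have "open N" unfolding N_def using B(1) assms(1) finJ
        by (intro open_Diff open_Int closed_UN) auto
      moreover have "x \<notin> cball (c i) (r i)" if "i \<in> J - {j}" for i
        using disj[of i j] that j jI unfolding J_def by blast
      then have "x \<in> N"
        using n(1) j(2) inG[OF jI] by (auto simp: N_def)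
      moreover have "x \<in> closure (- cball (c j) (r j))"
        using xs by (auto simp: closure_complement)
      ultimately have "N \<inter> - cball (c j) (r j) \<noteq> {}"
        by (meson disjoint_iff open_Int_closure_eq_empty)
      then show ?thesis using j(1) by (auto simp: N_def)
    next
      case False
      define N where "N = B n - (\<Union>i\<in>J. cball (c i) (r i))"
      have "open N" unfolding N_def using B(1) finJ by (intro open_Diff closed_UN) auto
      moreover have "x \<in> N" using n False by (auto simp: N_def)
      ultimately have "N \<inter> G \<noteq> {}"
        using x(1) by (meson disjoint_iff open_Int_closure_eq_empty)
      then show ?thesis by (auto simp: N_def)
    qed
    then obtain y where y: "y \<in> B n \<inter> G - (\<Union>i\<in>J. cball (c i) (r i))" by blast
    have "open (B n \<inter> G - (\<Union>i\<in>J. cball (c i) (r i)))"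
      using B(1) assms(1) finJ by (intro open_Diff open_Int closed_UN) auto
    then have "\<exists>s>0. cball y s \<subseteq> B n \<inter> G - (\<Union>i\<in>J. cball (c i) (r i))"
      using y by (rule open_contains_cball[THEN iffD1, THEN bspec])
    then obtain s where s: "s > 0" "cball y s \<subseteq> B n \<inter> G - (\<Union>i\<in>J. cball (c i) (r i))"
      by metis
    have "ok n (f ` {..<n}) (y, s)"
    proof -
      have "cball y s \<inter> cball (fst b') (snd b') = {}" if b': "Some b' \<in> f ` {..<n}" for b'
      proof -
        obtain j where j: "j < n" "f j = Some b'" using b' by (metis imageE lessThan_iff)
        then have "j \<in> J" by (auto simp: J_def I_def)
        moreover have "b' = (c j, r j)" using j by (simp add: c_def r_def)
        moreover have "cball y s \<inter> cball (c j) (r j) = {}"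
          using s(2) \<open>j \<in> J\<close> by blast
        ultimately show ?thesis by simp
      qed
      moreover have "cball y s \<subseteq> B n \<inter> G" using s(2) by blast
      ultimately show ?thesis using s(1) by (simp add: ok_def)
    qed
    \<comment> \<open>Since a ball fits at stage \<open>n\<close>, one was chosen there; it serves
      even if it is not \<open>cball y s\<close>.\<close>
    then have "f n \<noteq> None" using f[of n] by (metis option.simps(4))
    then have "n \<in> I" by (simp add: I_def)
    then show ?thesis using inB n by blast
  qed
  show thesis by (rule that[OF pos inG B(3) disj dense])
qed

lemma frequently_at_within:
  "(\<exists>\<^sub>F y in at x within G. P y) \<longleftrightarrow> (\<forall>U. open U \<longrightarrow> x \<in> U \<longrightarrow> (\<exists>y\<in>U \<inter> G. y \<noteq> x \<and> P y))"
  by (auto simp: frequently_def eventually_at_topological)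

section \<open>Filling open sets and inserting single values\<close>

definition fillable :: "'w rel \<Rightarrow> 'w \<Rightarrow> 'a::topological_space set \<Rightarrow> bool" where
  "fillable R w G \<longleftrightarrow> (\<exists>g. fills R w G g \<and> g ` G \<subseteq> R `` {w})"

text \<open>The value \<open>t\<close> at \<open>c\<close> is exempt from lying in \<open>S\<close>;
  this is what later allows a value to occur exactly once.\<close>

definition insertable ::
    "'w rel \<Rightarrow> 'w set \<Rightarrow> 'w \<Rightarrow> 'w \<Rightarrow> 'a::topological_space set \<Rightarrow> 'a \<Rightarrow> bool" where
  "insertable R S w t G c \<longleftrightarrow> (\<exists>g. fills R w G g \<and> g c = t \<and> g ` (G - {c}) \<subseteq> S)"

lemma insertable_mono: "insertable R S w t G c \<Longrightarrow> S \<subseteq> T \<Longrightarrow> insertable R T w t G c"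
  unfolding insertable_def by blast

text \<open>The cone of \<open>v\<close> is a single cluster here, and all its members have the same
  successors; a colouring in which each of them is dense shows them everywhere.\<close>

lemma fillable_maximal:
  fixes G :: "'a::euclidean_space set" and R :: "'w rel"
  assumes "trans R" "(v, v) \<in> R" "countable (R `` {v})"
    and max: "\<And>u. (v, u) \<in> R \<Longrightarrow> (u, v) \<in> R" and "open G"
  shows "fillable R v G"
proof -
  have "R `` {v} \<noteq> {}" using assms(2) by blast
  from dense_colouring[OF assms(3) this]
  obtain e :: "'a \<Rightarrow> 'w" where e: "range e \<subseteq> R `` {v}"
    "\<And>a U. a \<in> R `` {v} \<Longrightarrow> open U \<Longrightarrow> U \<noteq> {} \<Longrightarrow> \<exists>y\<in>U. e y = a"
    by metis
  have *: "sees R e (at x within G) w" if x: "x \<in> closure G" and w: "w \<in> R `` {v}" for x w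
  proof -
    have "(w, e y) \<in> R" for y
      using e(1) w max assms(1) by (meson Image_singleton_iff range_subsetD transD)
    moreover have "\<exists>\<^sub>F y in at x within G. e y = u" if "(w, u) \<in> R" for u
      unfolding frequently_at_within
    proof (intro allI impI)
      fix U assume U: "open U" "x \<in> U"
      have u: "u \<in> R `` {v}" using that w assms(1) by (auto dest: transD)
      have "U \<inter> G \<noteq> {}" using U x by (meson disjoint_iff open_Int_closure_eq_empty)
      moreover have "U \<inter> G \<noteq> {x}" using U(1) assms(5) by (metis open_Int not_open_singleton)
      ultimately have "U \<inter> G - {x} \<noteq> {}" by blast
      moreover have "open (U \<inter> G - {x})" using U assms(5) by auto
      ultimately obtain y where "y \<in> U \<inter> G - {x}" "e y = u" using e(2)[OF u] by blast
      then show "\<exists>y\<in>U \<inter> G. y \<noteq> x \<and> e y = u" by blast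
    qed
    ultimately show ?thesis by (simp add: sees_def)
  qed
  have "sees R e (at x) (e x)" if "x \<in> G" for x
    using *[of x "e x"] that e(1) assms(5) closure_subset
    by (metis at_within_open rangeI subsetD)
  moreover have "sees R e (at x within G) v" if "x \<in> frontier G" for x
    using * that assms(2) by (auto simp: frontier_def)
  ultimately have "fills R v G e" by (simp add: fills_def)
  then show ?thesis unfolding fillable_def using e(1) by blast
qed

text \<open>The balls are labelled by pairs: the first component, a strict successor of \<^term>\<open>v\<close>, is
  realised inside the ball, the second, a member of the cluster of \<^term>\<open>v\<close>, colours its
  boundary sphere.\<close>

lemma fillable_carpet:
  fixes G :: "'a::euclidean_space set"
  assumes "trans R" "(v, v) \<in> R" "countable (R `` {v})" "(v, m) \<in> R" "(m, v) \<notin> R" "open G"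
    and pieces: "\<And>u (c::'a) r. (v, u) \<in> R \<Longrightarrow> (u, v) \<notin> R \<Longrightarrow> 0 < r \<Longrightarrow>
      \<exists>g. (\<forall>x\<in>ball c r. sees R g (at x) (g x)) \<and> u \<in> g ` ball c r \<and>
          g ` ball c r \<subseteq> insert u (R `` {u})"
  shows "fillable R v G"
proof -
  define C where "C = {a. (v, a) \<in> R \<and> (a, v) \<in> R}"
  define L where "L = {u. (v, u) \<in> R \<and> (u, v) \<notin> R} \<times> C"
  have "L \<subseteq> R `` {v} \<times> R `` {v}" by (auto simp: L_def C_def)
  then have "countable L" using assms(3) by (meson countable_SIGMA countable_subset)
  moreover have "(m, v) \<in> L" using assms by (simp add: L_def C_def)
  then have "L \<noteq> {}" by blast
  ultimately have "countable L" "L \<noteq> {}" by auto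
  then obtain I :: "nat set" and c :: "nat \<Rightarrow> 'a" and r l
    where pos: "\<And>i. i \<in> I \<Longrightarrow> 0 < r i" and inG: "\<And>i. i \<in> I \<Longrightarrow> cball (c i) (r i) \<subseteq> G"
      and l: "\<And>i. l i \<in> L"
      and disj: "\<And>i j. i \<in> I \<Longrightarrow> j \<in> I \<Longrightarrow> i \<noteq> j \<Longrightarrow> cball (c i) (r i) \<inter> cball (c j) (r j) = {}"
      and dense: "\<And>U x a. open U \<Longrightarrow> x \<in> U \<Longrightarrow> x \<in> closure G \<Longrightarrow> x \<notin> (\<Union>i\<in>I. ball (c i) (r i)) \<Longrightarrow>
        a \<in> L \<Longrightarrow> \<exists>i\<in>I. l i = a \<and> cball (c i) (r i) \<subseteq> U"
    by (rule dense_ball_family[OF assms(6)]) (rule that)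
  have "\<exists>g. (\<forall>x\<in>ball (c i) (r i). sees R g (at x) (g x)) \<and> fst (l i) \<in> g ` ball (c i) (r i) \<and>
        g ` ball (c i) (r i) \<subseteq> insert (fst (l i)) (R `` {fst (l i)})" if "i \<in> I" for i
    using pieces[of "fst (l i)" "r i" "c i"] pos[OF that] l[of i] by (auto simp: L_def)
  then obtain \<gamma> where \<gamma>: "\<And>i x. i \<in> I \<Longrightarrow> x \<in> ball (c i) (r i) \<Longrightarrow> sees R (\<gamma> i) (at x) (\<gamma> i x)"
      "\<And>i. i \<in> I \<Longrightarrow> fst (l i) \<in> \<gamma> i ` ball (c i) (r i)"
      "\<And>i. i \<in> I \<Longrightarrow> \<gamma> i ` ball (c i) (r i) \<subseteq> insert (fst (l i)) (R `` {fst (l i)})"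
    by metis
  define idx where "idx x = (SOME i. i \<in> I \<and> x \<in> cball (c i) (r i))" for x
  have idx: "idx x = i" if "i \<in> I" "x \<in> cball (c i) (r i)" for i x
  proof -
    have "idx x \<in> I \<and> x \<in> cball (c (idx x)) (r (idx x))"
      unfolding idx_def by (rule someI[of _ i]) (use that in blast)
    then show ?thesis using disj[of "idx x" i] that by blast
  qed
  \<comment> \<open>Carpet points on no sphere get the default \<open>v\<close>, so off the open
    balls all values lie in the cluster \<open>C\<close>.\<close>
  define g where "g x = (if x \<in> (\<Union>i\<in>I. ball (c i) (r i)) then \<gamma> (idx x) x
      else if x \<in> (\<Union>i\<in>I. cball (c i) (r i)) then snd (l (idx x)) else v)" for x
  have g_ball: "g x = \<gamma> i x" if "i \<in> I" "x \<in> ball (c i) (r i)" for i x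
  proof -
    have "x \<in> cball (c i) (r i)" using that by simp
    then have "idx x = i" using idx that(1) by blast
    then show ?thesis using that by (auto simp: g_def)
  qed
  have g_sphere: "g x = snd (l i)" if i: "i \<in> I" "x \<in> sphere (c i) (r i)" for i x
  proof -
    have xi: "x \<in> cball (c i) (r i)" using i by simp
    have "x \<notin> ball (c j) (r j)" if "j \<in> I" for j
    proof (cases "i = j")
      case False
      then have "x \<notin> cball (c j) (r j)" using disj[of i j] xi i(1) that by blast
      then show ?thesis using ball_subset_cball by blast
    qed (use i in auto)
    then show ?thesis using i(1) xi idx[OF i(1) xi] by (auto simp: g_def)
  qed
  have g_K: "g x \<in> C" if "x \<notin> (\<Union>i\<in>I. ball (c i) (r i))" for x
    using that l assms(2) by (auto simp: g_def L_def C_def mem_Times_iff)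
  have g_R: "(v, g x) \<in> R" for x
  proof (cases "x \<in> (\<Union>i\<in>I. ball (c i) (r i))")
    case True
    then obtain i where i: "i \<in> I" "x \<in> ball (c i) (r i)" by blast
    have "g x = fst (l i) \<or> (fst (l i), g x) \<in> R"
      using \<gamma>(3)[OF i(1)] g_ball[OF i] i(2) by blast
    moreover have "(v, fst (l i)) \<in> R" using l[of i] by (auto simp: L_def)
    ultimately show ?thesis using assms(1) by (metis transD)
  next
    case False
    then show ?thesis using g_K by (simp add: C_def)
  qed
  have carpet: "sees R g (at x within G) w"
    if x: "x \<in> closure G" "x \<notin> (\<Union>i\<in>I. ball (c i) (r i))" and w: "w \<in> C" for x w
  proof -
    have "\<exists>\<^sub>F y in at x within G. g y = u" if "(w, u) \<in> R" for u
      unfolding frequently_at_within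
    proof (intro allI impI)
      fix U assume U: "open U" "x \<in> U"
      have vu: "(v, u) \<in> R" using that w transD[OF assms(1)] by (auto simp: C_def)
      show "\<exists>y\<in>U \<inter> G. y \<noteq> x \<and> g y = u"
      \<comment> \<open>A cluster member is found on a sphere, a strict successor inside a ball;
        \<open>m\<close> and \<open>v\<close> complete the label to a pair.\<close>
      proof (cases "(u, v) \<in> R")
        case True
        then have "(m, u) \<in> L" using vu assms by (simp add: L_def C_def)
        then obtain i where i: "i \<in> I" "l i = (m, u)" "cball (c i) (r i) \<subseteq> U"
          using dense[OF U x] by blast
        \<comment> \<open>The point \<open>x\<close> may itself lie on the sphere found; of two
          antipodal points at least one differs from it.\<close>
        obtain b :: 'a where b: "b \<in> Basis" using nonempty_Basis by blast
        have s: "c i + r i *\<^sub>R b \<in> sphere (c i) (r i)" "c i - r i *\<^sub>R b \<in> sphere (c i) (r i)"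
          using b pos[OF i(1)] by (auto simp: dist_norm)
        have "(c i + r i *\<^sub>R b) \<bullet> b \<noteq> (c i - r i *\<^sub>R b) \<bullet> b"
          using b pos[OF i(1)] by (simp add: inner_add_left inner_diff_left)
        then have "c i + r i *\<^sub>R b \<noteq> c i - r i *\<^sub>R b" by metis
        then obtain y where y: "y \<in> sphere (c i) (r i)" "y \<noteq> x" using s by metis
        then have "g y = u" using g_sphere[OF i(1)] i(2) by simp
        moreover have "y \<in> U \<inter> G" using y(1) i inG[OF i(1)] by auto
        ultimately show ?thesis using y by blast
      next
        case False
        then have "(u, v) \<in> L" using vu assms by (simp add: L_def C_def)
        then obtain i where i: "i \<in> I" "l i = (u, v)" "cball (c i) (r i) \<subseteq> U"
          using dense[OF U x] by blast
        obtain y where y: "y \<in> ball (c i) (r i)" "\<gamma> i y = u" using \<gamma>(2)[OF i(1)] i(2) by auto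
        then have "g y = u" using g_ball[OF i(1)] by simp
        moreover have "y \<in> U \<inter> G" using y(1) i inG[OF i(1)] by auto
        moreover have "y \<noteq> x" using x(2) y(1) i(1) by blast
        ultimately show ?thesis by blast
      qed
    qed
    moreover have "(w, g y) \<in> R" for y
      using g_R[of y] w transD[OF assms(1)] unfolding C_def by blast
    ultimately show ?thesis by (simp add: sees_def)
  qed
  have "sees R g (at x) (g x)" if "x \<in> G" for x
  proof (cases "x \<in> (\<Union>i\<in>I. ball (c i) (r i))")
    case True
    then obtain i where i: "i \<in> I" "x \<in> ball (c i) (r i)" by blast
    have "\<forall>\<^sub>F y in at x. g y = \<gamma> i y"
      unfolding eventually_at_topological
      by (intro exI[of _ "ball (c i) (r i)"]) (use i g_ball[OF i(1)] in auto)
    then have "sees R g (at x) (g x) \<longleftrightarrow> sees R (\<gamma> i) (at x) (g x)" by (rule sees_cong)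
    then show ?thesis using \<gamma>(1)[OF i] g_ball[OF i] by simp
  next
    case False
    then show ?thesis using carpet[OF _ False g_K[OF False]] that assms(6) closure_subset
      by (metis at_within_open subsetD)
  qed
  moreover have "sees R g (at x within G) v" if "x \<in> frontier G" for x
  proof -
    have "x \<in> closure G" "x \<notin> G" using that assms(6) by (auto simp: frontier_def interior_open)
    moreover have "x \<notin> (\<Union>i\<in>I. ball (c i) (r i))"
      using inG \<open>x \<notin> G\<close> ball_subset_cball by blast
    ultimately show ?thesis using carpet assms(2) by (simp add: C_def)
  qed
  ultimately have "fills R v G g" by (simp add: fills_def)
  then show ?thesis using g_R unfolding fillable_def by blast
qed

text \<open>Puncturing \<open>G\<close> at \<open>c\<close> makes \<open>c\<close> a frontier point,
  where a filling labelled \<open>w\<close> looks as it should around a point of value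
  \<open>w\<close>; the puncture is then closed with \<open>w\<close>.\<close>

lemma insertable_reflexive:
  fixes G :: "'a::euclidean_space set"
  assumes "open G" "c \<in> G" "(w, w) \<in> R" "R `` {w} \<subseteq> S" "fillable R w (G - {c})"
  shows "insertable R S w w G c"
proof -
  obtain g where g: "fills R w (G - {c}) g" "g ` (G - {c}) \<subseteq> R `` {w}"
    using assms(5) by (auto simp: fillable_def)
  define h where "h = g(c := w)"
  have opn: "open (G - {c})" using assms(1) by auto
  have h: "fills R w (G - {c}) h" by (rule fills_cong_imp[OF g(1) opn]) (simp add: h_def)
  have cl: "closure (G - {c}) = closure G"
  proof -
    have "c islimpt G" using assms(1,2) by (simp add: interior_limit_point interior_open)
    then have "c \<in> closure (G - {c})" by (simp add: islimpt_in_closure)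
    moreover have "closure G \<subseteq> insert c (closure (G - {c}))"
      by (metis closure_insert insert_Diff_single subset_insertI)
    ultimately show ?thesis using closure_mono[of "G - {c}" G] by blast
  qed
  have "sees R h (at c) w"
  proof -
    have "c \<in> frontier (G - {c})"
      using assms(2) opn cl closure_subset by (auto simp: frontier_def interior_open)
    then have "sees R h (at c within (G - {c})) w" using h by (simp add: fills_def)
    moreover have "at c within (G - {c}) = at c"
      using at_within_nhd[OF assms(2,1), of "G - {c}" UNIV] by auto
    ultimately show ?thesis by simp
  qed
  moreover have "sees R h (at x) (h x)" if "x \<in> G - {c}" for x using h that by (simp add: fills_def)
  ultimately have "sees R h (at x) (h x)" if "x \<in> G" for x
    using that by (cases "x = c") (auto simp: h_def)
  moreover have "sees R h (at x within G) w" if "x \<in> frontier G" for x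
  proof -
    have x: "x \<notin> G" "x \<in> closure G" using that assms(1) by (auto simp: frontier_def interior_open)
    then have "x \<in> frontier (G - {c})" using opn cl by (simp add: frontier_def interior_open)
    moreover have "at x within (G - {c}) = at x within G"
      by (rule at_within_nhd[of x "- {c}"]) (use x assms(2) in auto)
    ultimately show ?thesis using h by (metis fills_def)
  qed
  ultimately have "fills R w G h" by (simp add: fills_def)
  then show ?thesis unfolding insertable_def
    by (intro exI[of _ h]) (use g(2) assms(3,4) in \<open>auto simp: h_def\<close>)
qed

text \<open>Changes the label from \<open>w2\<close> to a comparable \<open>w1\<close>: a ball
  around \<open>c\<close> carries the old piece, the rest is filled for \<open>w1\<close>, and
  whichever of the two sees the other colours the sphere.\<close>

lemma insertable_step:
  fixes G :: "'a::euclidean_space set"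
  assumes "trans R" "open G" "c \<in> G"
    and ins: "\<And>G'. open G' \<Longrightarrow> c \<in> G' \<Longrightarrow> insertable R S w2 t G' c"
    and fil: "\<And>G'::'a set. open G' \<Longrightarrow> fillable R w1 G'"
    and cmp: "(w1, w2) \<in> R \<or> (w2, w1) \<in> R" and ww: "(w1, w1) \<in> R" "(w2, w2) \<in> R"
    and S: "R `` {w1} \<subseteq> S" "w2 \<in> S"
  shows "insertable R S w1 t G c"
proof -
  obtain r where r: "0 < r" "cball c r \<subseteq> G" using assms(2,3) open_contains_cball by blast
  obtain g2 where g2: "fills R w2 (ball c r) g2" "g2 c = t" "g2 ` (ball c r - {c}) \<subseteq> S"
    using ins[of "ball c r"] r by (auto simp: insertable_def)
  obtain g1 where g1: "fills R w1 (G - cball c r) g1" "g1 ` (G - cball c r) \<subseteq> R `` {w1}"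
    using fil[of "G - cball c r"] assms(2) by (auto simp: fillable_def)
  define s where "s = (if (w1, w2) \<in> R then w1 else w2)"
  have "fills R w1 G (\<lambda>x. if x \<in> ball c r then g2 x else if x \<in> sphere c r then s else g1 x)"
    by (rule fills_glue[OF assms(1,2) r(2,1) g1(1) g2(1)]) (use cmp ww in \<open>auto simp: s_def\<close>)
  moreover have "s \<in> S" using S ww by (auto simp: s_def)
  ultimately show ?thesis unfolding insertable_def
  proof (intro exI conjI)
    show "(\<lambda>x. if x \<in> ball c r then g2 x else if x \<in> sphere c r then s else g1 x) ` (G - {c}) \<subseteq> S"
    proof (rule image_subsetI)
      fix x assume x: "x \<in> G - {c}"
      consider "x \<in> ball c r" | "x \<in> sphere c r" | "x \<in> G - cball c r" "x \<notin> ball c r" "x \<notin> sphere c r"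
        using x by force
      then show "(if x \<in> ball c r then g2 x else if x \<in> sphere c r then s else g1 x) \<in> S"
        by cases (use x g1(2) g2(3) S \<open>s \<in> S\<close> in \<open>auto simp: image_subset_iff subset_iff\<close>)
    qed
  qed (use r g2 in auto)
qed

text \<open>Each point gets a ball that avoids the remaining ones. Both sides of its sphere carry
  the label \<open>w\<close>, so the sphere can have the colour \<open>w\<close>.\<close>

lemma insertable_finite:
  fixes P :: "'a::euclidean_space set"
  assumes "trans R" "finite P" "(w, w) \<in> R" "R `` {w} \<subseteq> S"
    and ins: "\<And>G p. open G \<Longrightarrow> p \<in> G \<Longrightarrow> p \<in> P \<Longrightarrow> insertable R S w (\<tau> p) G p"
    and fil: "\<And>G::'a set. open G \<Longrightarrow> fillable R w G"
  shows "open G \<Longrightarrow> P \<subseteq> G \<Longrightarrow> \<exists>g. fills R w G g \<and> (\<forall>p\<in>P. g p = \<tau> p) \<and> g ` (G - P) \<subseteq> S"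
  using assms(2) ins
proof (induction P arbitrary: G rule: finite_induct)
  case empty
  then show ?case using fil[of G] assms(4) unfolding fillable_def by blast
next
  case (insert p P)
  have "open (G - P)" "p \<in> G - P"
    using insert.prems insert.hyps by (auto simp: open_Diff finite_imp_closed)
  then obtain r where r: "0 < r" "cball p r \<subseteq> G - P" using open_contains_cball by blast
  then have r': "cball p r \<subseteq> G" by blast
  have PG: "P \<subseteq> G - cball p r" using r insert.prems(2) by blast
  have "\<exists>g. fills R w (G - cball p r) g \<and> (\<forall>p\<in>P. g p = \<tau> p) \<and> g ` (G - cball p r - P) \<subseteq> S"
    by (rule insert.IH[OF _ PG]) (use insert.prems in \<open>auto simp: open_Diff\<close>)
  then obtain g1 where g1: "fills R w (G - cball p r) g1" "\<And>q. q \<in> P \<Longrightarrow> g1 q = \<tau> q"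
      "g1 ` (G - cball p r - P) \<subseteq> S"
    by blast
  obtain g2 where g2: "fills R w (ball p r) g2" "g2 p = \<tau> p" "g2 ` (ball p r - {p}) \<subseteq> S"
    using insert.prems(3)[of "ball p r" p] r by (auto simp: insertable_def)
  define h where "h x = (if x \<in> ball p r then g2 x else if x \<in> sphere p r then w else g1 x)" for x
  have "fills R w G h"
    unfolding h_def
    by (rule fills_glue[OF assms(1) insert.prems(1) r' r(1) g1(1) g2(1)]) (use assms in auto)
  moreover have "h p = \<tau> p" using r g2 by (simp add: h_def)
  moreover have "h q = \<tau> q" if "q \<in> P" for q
  proof -
    have "q \<notin> cball p r" using r(2) that by blast
    then show ?thesis using g1(2)[OF that] by (auto simp: h_def)
  qed
  moreover have "h x \<in> S" if x: "x \<in> G - insert p P" for x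
  proof -
    consider "x \<in> ball p r" | "x \<in> sphere p r" | "x \<in> G - cball p r" "x \<notin> ball p r" "x \<notin> sphere p r"
      using x by force
    then show ?thesis
      by cases (use x g1(3) g2(3) assms(3,4) in \<open>auto simp: h_def image_subset_iff subset_iff\<close>)
  qed
  then have "h ` (G - insert p P) \<subseteq> S" by (rule image_subsetI)
  ultimately show ?case by blast
qed

section \<open>Realising finite frames\<close>

text \<open>Shells shrinking to \<^term>\<open>c\<close>, each with one point inserted, so that every successor of
  \<^term>\<open>t\<close> is realised in infinitely many of them.\<close>

lemma insertable_irreflexive:
  fixes G :: "'a::euclidean_space set" and R :: "'w rel"
  assumes "trans R" "open G" "c \<in> G" "(t, w) \<in> R" "(w, w) \<in> R" "countable (R `` {t})"
    and fil: "\<And>G::'a set. open G \<Longrightarrow> fillable R w G"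
    and ins: "\<And>u (G::'a set) p. (t, u) \<in> R \<Longrightarrow> open G \<Longrightarrow> p \<in> G \<Longrightarrow> insertable R (R `` {t}) w u G p"
  shows "insertable R (R `` {t}) w t G c"
proof -
  obtain \<rho> where \<rho>: "0 < \<rho>" "cball c \<rho> \<subseteq> G" using assms(2,3) open_contains_cball by blast
  \<comment> \<open>A strictly decreasing null sequence starting at \<open>\<rho>\<close>.
    \<open>A 0\<close> is the part outside the first sphere, \<open>A (Suc k)\<close> the shell
    between radii \<open>r k\<close> and \<open>r (Suc k)\<close>, and \<open>p k\<close> lies
    halfway across that shell.\<close>
  define r where "r k = \<rho> / (real k + 1)" for k
  define B where "B k = (case k of 0 \<Rightarrow> G | Suc j \<Rightarrow> ball c (r j))" for k
  define A where "A k = B k - cball c (r k)" for k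
  have pos: "0 < r k" for k using \<rho> by (simp add: r_def)
  have dec: "r j < r k" if "k < j" for j k
    using that \<rho> by (simp add: r_def divide_strict_left_mono)
  have dec': "r j \<le> r k" if "k \<le> j" for j k
    using dec[of k j] that by (cases "k = j") auto
  have small: "\<exists>m. r m < d" if "0 < d" for d
  proof -
    obtain m where "\<rho> / d < real m" using reals_Archimedean2 by blast
    then have "\<rho> < d * (real m + 1)" using that by (simp add: field_simps)
    then have "r m < d" by (simp add: r_def divide_less_eq mult.commute)
    then show ?thesis ..
  qed
  have openB: "open (B k)" for k using assms(2) by (simp add: B_def split: nat.split)
  have openA: "open (A k)" for k using openB by (simp add: A_def open_Diff)
  have subB: "cball c (r k) \<subseteq> B k" for k
  proof (cases k)
    case 0
    then show ?thesis using \<rho> by (simp add: B_def r_def)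
  next
    case (Suc j)
    have "cball c (r (Suc j)) \<subseteq> ball c (r j)" using dec[of j "Suc j"] by (auto simp: subset_eq)
    then show ?thesis using Suc by (simp add: B_def)
  qed
  obtain b :: 'a where b: "b \<in> Basis" using nonempty_Basis by blast
  define p where "p k = c + ((r k + r (Suc k)) / 2) *\<^sub>R b" for k
  have dist_p: "dist c (p k) = (r k + r (Suc k)) / 2" for k
    using b pos[of k] pos[of "Suc k"] by (simp add: p_def dist_norm)
  have p: "p k \<in> A (Suc k)" "dist c (p k) < r k" for k
    using dec[of k "Suc k"] by (auto simp: A_def B_def dist_p)
  \<comment> \<open>Projecting an enumeration of pairs makes each successor of \<open>t\<close>
    recur beyond every index.\<close>
  define \<tau> where "\<tau> k = from_nat_into (R `` {t}) (fst (prod_decode k))" for k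
  have "R `` {t} \<noteq> {}" using assms(4) by blast
  then have \<tau>: "(t, \<tau> k) \<in> R" for k
    using from_nat_into[of "R `` {t}"] by (auto simp: \<tau>_def)
  have \<tau>_inf: "\<exists>k\<ge>m. \<tau> k = u" if u: "(t, u) \<in> R" for u m
  proof -
    obtain j where "from_nat_into (R `` {t}) j = u"
      using from_nat_into_surj[OF assms(6), of u] u by blast
    then show ?thesis
      by (intro exI[of _ "prod_encode (j, m)"]) (simp add: \<tau>_def le_prod_encode_2)
  qed
  have "\<exists>h. fills R w (A k) h \<and> h ` A k \<subseteq> R `` {t} \<and> (\<forall>j. k = Suc j \<longrightarrow> h (p j) = \<tau> j)" for k
  proof (cases k)
    case 0
    obtain h where "fills R w (A 0) h" "h ` A 0 \<subseteq> R `` {w}"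
      using fil[OF openA] unfolding fillable_def by blast
    moreover have "R `` {w} \<subseteq> R `` {t}" using assms(1,4) by (auto dest: transD)
    ultimately show ?thesis using 0 by blast
  next
    case (Suc j)
    obtain h where h: "fills R w (A (Suc j)) h" "h (p j) = \<tau> j"
        "h ` (A (Suc j) - {p j}) \<subseteq> R `` {t}"
      using ins[OF \<tau>[of j] openA p(1)] unfolding insertable_def by blast
    have "h ` A (Suc j) \<subseteq> R `` {t}"
    proof (rule image_subsetI)
      fix x assume "x \<in> A (Suc j)"
      then show "h x \<in> R `` {t}"
        using h(2,3) \<tau>[of j] by (cases "x = p j") (auto simp: image_subset_iff)
    qed
    then show ?thesis using Suc h by (intro exI[of _ h]) simp
  qed
  then obtain \<gamma> where \<gamma>: "\<And>k. fills R w (A k) (\<gamma> k)" "\<And>k. \<gamma> k ` A k \<subseteq> R `` {t}"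
      "\<And>j. \<gamma> (Suc j) (p j) = \<tau> j"
    by metis
  define idx where "idx y = (LEAST k. r k < dist c y)" for y
  define g where "g y = (if y = c then t else if dist c y \<in> range r then w else \<gamma> (idx y) y)" for y
  have g_A: "g y = \<gamma> k y" if y: "y \<in> A k" for y k
  proof -
    have gt: "r k < dist c y" using y by (simp add: A_def)
    have lt: "dist c y < r i" if "i < k" for i
    proof (cases k)
      case (Suc j)
      then have "dist c y < r j" using y by (simp add: A_def B_def)
      also have "r j \<le> r i" using dec' that Suc by simp
      finally show ?thesis .
    qed (use that in simp)
    have "idx y = k" unfolding idx_def
    proof (rule Least_equality)
      show "r k < dist c y" by (rule gt)
      show "k \<le> j" if "r j < dist c y" for j
        using lt[of j] that by (meson not_less order.asym)
    qed
    moreover have "dist c y \<noteq> r i" for i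
      using lt[of i] dec'[of k i] gt by (cases "i < k") auto
    moreover have "y \<noteq> c" using gt pos[of k] by auto
    ultimately show ?thesis by (auto simp: g_def)
  qed
  have cover: "y = c \<or> (\<exists>k. y \<in> sphere c (r k)) \<or> (\<exists>k. y \<in> A k)" if "y \<in> G" for y
  proof (cases "y = c")
    case False
    then have "\<exists>k. r k < dist c y" using small[of "dist c y"] by simp
    then have k: "r (idx y) < dist c y" "\<And>j. r j < dist c y \<Longrightarrow> idx y \<le> j"
      unfolding idx_def by (auto intro: LeastI Least_le)
    show ?thesis
    proof (cases "idx y")
      case 0
      then have "y \<in> A 0" using k that by (simp add: A_def B_def)
      then show ?thesis by blast
    next
      case (Suc j)
      then have le: "dist c y \<le> r j" using k(2)[of j] by force
      show ?thesis
      proof (cases "dist c y = r j")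
        case True
        then have "y \<in> sphere c (r j)" by simp
        then show ?thesis by blast
      next
        case False
        then have "y \<in> A (Suc j)" using le k(1) Suc by (simp add: A_def B_def)
        then show ?thesis by blast
      qed
    qed
  qed simp
  have fills_A: "fills R w (A k) g" for k
    by (rule fills_cong_imp[OF \<gamma>(1) openA]) (rule g_A)
  have g_sphere: "g y = w" if "y \<in> sphere c (r k)" for y k
    using that pos[of k] by (auto simp: g_def)
  have g_R: "(t, g y) \<in> R" if "y \<in> G" "y \<noteq> c" for y
    using cover[OF that(1)] that(2)
  proof (elim disjE exE)
    fix k assume "y \<in> A k"
    then show ?thesis using \<gamma>(2)[of k] g_A by auto
  qed (use g_sphere assms(4) in auto)
  have center: "sees R g (at c) t"
    unfolding sees_def
  proof (intro conjI allI impI)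
    show "\<forall>\<^sub>F y in at c. (t, g y) \<in> R"
      unfolding eventually_at_topological using assms(2,3) g_R by blast
  next
    fix u assume u: "(t, u) \<in> R"
    have "\<exists>y\<in>U \<inter> UNIV. y \<noteq> c \<and> g y = u" if U: "open U" "c \<in> U" for U
    proof -
      obtain \<delta> where \<delta>: "0 < \<delta>" "ball c \<delta> \<subseteq> U" using U open_contains_ball by blast
      obtain m where m: "r m < \<delta>" using small \<delta> by blast
      obtain k where k: "m \<le> k" "\<tau> k = u" using \<tau>_inf u by blast
      have "dist c (p k) < \<delta>" using p(2)[of k] dec'[OF k(1)] m by linarith
      then have "p k \<in> U" using \<delta> by auto
      moreover have "g (p k) = u" using g_A[OF p(1)] \<gamma>(3) k by simp
      moreover have "p k \<noteq> c" using dist_p[of k] pos[of k] pos[of "Suc k"] by auto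
      ultimately show ?thesis by blast
    qed
    then show "\<exists>\<^sub>F y in at c. g y = u" using frequently_at_within[of _ c UNIV] by blast
  qed
  have "sees R g (at y) (g y)" if "y \<in> G" for y
    using cover[OF that]
  proof (elim disjE exE)
    assume "y = c"
    then show ?thesis using center by (simp add: g_def)
  next
    \<comment> \<open>Both neighbouring shells carry the label \<open>w\<close>, so the sphere
      between them fits with the colour \<open>w\<close>.\<close>
    fix k assume y: "y \<in> sphere c (r k)"
    have "ball c (r k) - cball c (r (Suc k)) = A (Suc k)" by (simp add: A_def B_def)
    then have f2: "fills R w (ball c (r k) - cball c (r (Suc k))) g" using fills_A by metis
    show ?thesis
      by (rule sees_sphere[OF assms(1) openB subB pos dec fills_A[unfolded A_def] f2 _ assms(5) _ y])
        (use assms(5) g_sphere in auto)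
  next
    fix k assume "y \<in> A k"
    then show ?thesis using fills_A unfolding fills_def by blast
  qed
  moreover have "sees R g (at x within G) w" if "x \<in> frontier G" for x
  proof (rule fills_outer[OF _ assms(2) \<rho>(2) that])
    have "A 0 = G - cball c \<rho>" by (simp add: A_def B_def r_def)
    then show "fills R w (G - cball c \<rho>) g" using fills_A[of 0] by simp
  qed
  ultimately have "fills R w G g" by (simp add: fills_def)
  moreover have "g c = t" by (simp add: g_def)
  ultimately show ?thesis unfolding insertable_def using g_R by (intro exI[of _ g]) auto
qed

text \<open>The clauses differ because an irreflexive value cannot recur near a point that has it:
  it is placed at one prescribed point, inside a piece labelled by a reflexive successor. The
  \<open>itself\<close> argument carries the type of the space.\<close>

definition realizable :: "'w rel \<Rightarrow> 'a::topological_space itself \<Rightarrow> 'w \<Rightarrow> bool" where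
  "realizable R _ w \<longleftrightarrow>
     ((w, w) \<in> R \<longrightarrow> (\<forall>G::'a set. open G \<longrightarrow> fillable R w G)) \<and>
     ((w, w) \<notin> R \<longrightarrow> (\<exists>v. (w, v) \<in> R \<and> (v, v) \<in> R \<and>
        (\<forall>(G::'a set) c. open G \<longrightarrow> c \<in> G \<longrightarrow> insertable R (R `` {w}) v w G c)))"

context kframe
begin

text \<open>Works outward from \<open>c\<close>: the innermost piece is labelled by \<open>t\<close>
  itself or, for irreflexive \<open>t\<close>, by a reflexive successor, and each edge of a path
  from there to \<open>v\<close> adds a layer around it. Other values lie in the image of
  \<open>S\<close> under \<open>R\<close>, so points of \<open>S\<close> without predecessors in
  \<open>S\<close> occur at most at \<open>c\<close>.\<close>

lemma insertable_connected:
  fixes G :: "'a::euclidean_space set"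
  assumes "S \<subseteq> W" "R `` S \<subseteq> S" "rconn R S" "v \<in> S" "(v, v) \<in> R" "t \<in> S"
    and real: "\<And>u. u \<in> S \<Longrightarrow> realizable R TYPE('a) u"
    and "open G" "c \<in> G"
  shows "insertable R (R `` S) v t G c"
proof -
  have fil: "fillable R u G'" if "u \<in> S" "(u, u) \<in> R" "open G'" for u and G' :: "'a set"
    using real that unfolding realizable_def by blast
  obtain v0 where v0: "v0 \<in> S" "(v0, v0) \<in> R"
    "\<And>(G::'a set) c. open G \<Longrightarrow> c \<in> G \<Longrightarrow> insertable R (R `` S) v0 t G c"
  proof (cases "(t, t) \<in> R")
    case True
    have "insertable R (R `` S) t t G' c'" if "open G'" "c' \<in> G'" for G' :: "'a set" and c'
      by (rule insertable_reflexive[OF that True])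
        (use assms(6) fil[OF assms(6) True] that in auto)
    then show ?thesis using that True assms(6) by blast
  next
    case False
    then obtain v0 where v0: "(t, v0) \<in> R" "(v0, v0) \<in> R"
      "\<And>(G::'a set) c. open G \<Longrightarrow> c \<in> G \<Longrightarrow> insertable R (R `` {t}) v0 t G c"
      using real[OF assms(6)] unfolding realizable_def by blast
    have sub: "R `` {t} \<subseteq> R `` S" using assms(6) by blast
    have "v0 \<in> S" using v0(1) assms(2,6) by blast
    then show ?thesis using v0(2) by (rule that) (rule insertable_mono[OF v0(3) sub])
  qed
  have "(v, v0) \<in> (rcomp R S)\<^sup>*"
    using reflexive_path[OF assms(1-5) v0(1,2)] .
  then have "\<forall>(G::'a set) c. open G \<longrightarrow> c \<in> G \<longrightarrow> insertable R (R `` S) v t G c"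
  proof (induction rule: converse_rtrancl_induct)
    case base
    then show ?case using v0(3) by blast
  next
    case (step y z)
    then have yz: "y \<in> S" "z \<in> S" "(y, y) \<in> R" "(z, z) \<in> R" "(y, z) \<in> R \<or> (z, y) \<in> R"
      by (auto simp: rcomp_def)
    show ?case
    proof (intro allI impI)
      fix G :: "'a set" and c assume "open G" "c \<in> G"
      then show "insertable R (R `` S) y t G c"
        by (rule insertable_step[OF tr, where ?w2.0 = z])
          (use step.IH yz fil in auto)
    qed
  qed
  then show ?thesis using assms by blast
qed

text \<open>The cone of an irreflexive point may coincide with the cone of a reflexive successor,
  whence the second summand of the measure.\<close>

lemma realizable:
  assumes "w \<in> W"
  shows "realizable R TYPE('a::euclidean_space) w"
  using assms
proof (induction "2 * card (R `` {w}) + (if (w, w) \<in> R then 0 else 1)" arbitrary: w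
    rule: less_induct)
  case less
  have count: "countable (R `` {w})" using finite_Image by (rule countable_finite)
  show ?case
  proof (cases "(w, w) \<in> R")
    case True
    have "fillable R w G" if G: "open G" for G :: "'a set"
    proof (cases "\<exists>m. (w, m) \<in> R \<and> (m, w) \<notin> R")
      case False
      then show ?thesis using fillable_maximal[OF tr True count _ G] by blast
    next
      case True
      then obtain m where m: "(w, m) \<in> R" "(m, w) \<notin> R" by blast
      show ?thesis
      proof (rule fillable_carpet[OF tr \<open>(w, w) \<in> R\<close> count m G])
        fix u and c :: 'a and r :: real
        assume u: "(w, u) \<in> R" "(u, w) \<notin> R" and "0 < r"
        have "R `` {u} \<subset> R `` {w}" using Image_mono[OF u(1)] u \<open>(w, w) \<in> R\<close> by blast
        then have "card (R `` {u}) < card (R `` {w})" using finite_Image psubset_card_mono by blast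
        moreover have "u \<in> W" using u Image_sub by blast
        \<comment> \<open>The factor 2 in the measure lets a smaller cone outweigh the summand that
          an irreflexive \<open>u\<close> adds.\<close>
        ultimately have real: "realizable R TYPE('a) u" using less.hyps[of u] \<open>(w, w) \<in> R\<close> by auto
        show "\<exists>g. (\<forall>x\<in>ball c r. sees R g (at x) (g x)) \<and> u \<in> g ` ball c r \<and>
            g ` ball c r \<subseteq> insert u (R `` {u})"
        proof -
          have "\<exists>v. insertable R (R `` {u}) v u (ball c r) c"
          proof (cases "(u, u) \<in> R")
            case True
            have "open (ball c r - {c})" by (simp add: open_Diff)
            then have "fillable R u (ball c r - {c})"
              using real True unfolding realizable_def by blast
            then have "insertable R (R `` {u}) u u (ball c r) c"
              using insertable_reflexive[OF open_ball _ True subset_refl] \<open>0 < r\<close> centre_in_ball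
              by blast
            then show ?thesis ..
          next
            case False
            then show ?thesis
              using real \<open>0 < r\<close> unfolding realizable_def by (meson centre_in_ball open_ball)
          qed
          then obtain v g where g: "fills R v (ball c r) g" "g c = u"
              "g ` (ball c r - {c}) \<subseteq> R `` {u}"
            unfolding insertable_def by blast
          moreover have "c \<in> ball c r" using \<open>0 < r\<close> by simp
          ultimately have "u \<in> g ` ball c r" "g ` ball c r \<subseteq> insert u (R `` {u})" by blast+
          then show ?thesis using g(1) unfolding fills_def by blast
        qed
      qed
    qed
    then show ?thesis using True by (simp add: realizable_def)
  next
    case False
    obtain v where v: "(w, v) \<in> R" "(v, v) \<in> R" using ex_reflexive less.prems by blast
    have real: "realizable R TYPE('a) u" if u: "u \<in> R `` {w}" for u
    proof -
      have le: "R `` {u} \<subseteq> R `` {w}" using Image_mono u by blast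
      have uW: "u \<in> W" using u Image_sub by blast
      show ?thesis
      proof (cases "(u, u) \<in> R")
        case True
        then show ?thesis
          using less.hyps[of u] uW False card_mono[OF finite_Image le] by auto
      next
        case irr: False
        then have "R `` {u} \<subset> R `` {w}" using u le by blast
        then have "card (R `` {u}) < card (R `` {w})" using finite_Image psubset_card_mono by blast
        then show ?thesis using less.hyps[of u] uW False irr by auto
      qed
    qed
    have up: "R `` R `` {w} \<subseteq> R `` {w}" using tr by (auto dest: transD)
    have ins: "insertable R (R `` {w}) v u G c" if "(w, u) \<in> R" "open G" "c \<in> G"
      for u and G :: "'a set" and c
    proof -
      have "insertable R (R `` R `` {w}) v u G c"
        by (rule insertable_connected[OF Image_sub up conn[OF less.prems] _ v(2) _ real that(2,3)])
          (use v(1) that(1) in simp_all)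
      then show ?thesis using up by (rule insertable_mono)
    qed
    have "fillable R v G" if "open G" for G :: "'a set"
      using real[of v] v that unfolding realizable_def by blast
    then have "insertable R (R `` {w}) v w G c" if "open G" "c \<in> G" for G :: "'a set" and c
      using insertable_irreflexive[OF tr that v count _ ins] by blast
    then show ?thesis using False v unfolding realizable_def by blast
  qed
qed

text \<open>Prescribed points do the counting: every element of \<open>W\<close> gets one point of
  \<open>P\<close>, and a second one unless it is in \<open>N\<close>. Away from \<open>P\<close>
  only values with predecessors occur, so nothing in \<open>N\<close> is repeated.\<close>

theorem frame_realization:
  assumes "W \<noteq> {}" "rconn R W" "N \<subseteq> W" "R `` W \<inter> N = {}"
  shows "\<exists>f :: 'a::euclidean_space \<Rightarrow> 'w. range f = W \<and> (\<forall>x. sees R f (at x) (f x)) \<and>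
    (\<forall>w\<in>W. (\<exists>x y. x \<noteq> y \<and> f x = w \<and> f y = w) \<longleftrightarrow> w \<notin> N)"
proof -
  obtain s where "s \<in> W" using assms(1) by blast
  then obtain v where "(s, v) \<in> R" "(v, v) \<in> R" using ex_reflexive by blast
  then have v: "v \<in> W" "(v, v) \<in> R" using sub by auto
  have up: "R `` W \<subseteq> W" using sub by auto
  define Q where "Q = W \<times> {False} \<union> (W - N) \<times> {True}"
  have "finite Q" using fin by (simp add: Q_def)
  have "infinite (UNIV :: 'a set)"
  proof
    assume "finite (UNIV :: 'a set)"
    then have "closed (- {0 :: 'a})" by (meson finite_imp_closed finite_subset subset_UNIV)
    then show False using not_open_singleton[of "0 :: 'a"] by (simp add: closed_def)
  qed
  then obtain P :: "'a set" where P: "finite P" "card P = card Q"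
    using infinite_arbitrarily_large by metis
  obtain j where j: "bij_betw j P Q" using finite_same_card_bij[OF P(1) \<open>finite Q\<close> P(2)] ..
  have jQ: "j p \<in> Q" if "p \<in> P" for p using j that by (auto simp: bij_betw_def)
  define \<tau> where "\<tau> p = fst (j p)" for p
  have \<tau>W: "\<tau> p \<in> W" if "p \<in> P" for p using jQ[OF that] by (auto simp: \<tau>_def Q_def)
  have ex: "\<exists>p\<in>P. j p = q" if "q \<in> Q" for q using j that by (metis bij_betw_def imageE)
  have fil: "fillable R v G" if "open G" for G :: "'a set"
    using realizable[OF v(1), where ?'a = 'a] v that unfolding realizable_def by blast
  have ins: "insertable R (R `` W) v (\<tau> p) G p" if "open G" "p \<in> G" "p \<in> P" for G p
    by (rule insertable_connected[OF subset_refl up assms(2) v])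
      (use realizable \<tau>W that in auto)
  have "R `` {v} \<subseteq> R `` W" using v by blast
  then obtain f where f: "fills R v UNIV f" "\<And>p. p \<in> P \<Longrightarrow> f p = \<tau> p" "f ` (UNIV - P) \<subseteq> R `` W"
    using insertable_finite[OF tr P(1) v(2) _ ins fil, of UNIV] by auto
  have "f x \<in> W" for x
    using f(2)[of x] f(3) \<tau>W[of x] up by (cases "x \<in> P") auto
  moreover have "\<exists>x. f x = w" if w: "w \<in> W" for w
  proof -
    have "(w, False) \<in> Q" using w by (simp add: Q_def)
    then obtain p where "p \<in> P" "j p = (w, False)" using ex by blast
    then have "f p = w" using f(2) by (simp add: \<tau>_def)
    then show ?thesis ..
  qed
  ultimately have "range f = W" by blast
  moreover have "(\<exists>x y. x \<noteq> y \<and> f x = w \<and> f y = w) \<longleftrightarrow> w \<notin> N" if w: "w \<in> W" for w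
  proof
    assume "\<exists>x y. x \<noteq> y \<and> f x = w \<and> f y = w"
    then obtain x y where xy: "x \<noteq> y" "f x = w" "f y = w" by blast
    show "w \<notin> N"
    proof
      assume N: "w \<in> N"
      have in_P: "z \<in> P \<and> j z = (w, False)" if "f z = w" for z
      proof -
        have "z \<in> P" using f(3) that N assms(4) by auto
        then show ?thesis using jQ[of z] f(2)[of z] that N by (auto simp: Q_def \<tau>_def)
      qed
      have "inj_on j P" using j by (simp add: bij_betw_def)
      then show False using in_P[OF xy(2)] in_P[OF xy(3)] xy(1) by (metis inj_onD)
    qed
  next
    assume "w \<notin> N"
    then obtain x y where "x \<in> P" "j x = (w, False)" "y \<in> P" "j y = (w, True)"
      using ex[of "(w, False)"] ex[of "(w, True)"] w by (auto simp: Q_def)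
    moreover from this have "x \<noteq> y" by auto
    ultimately have "x \<noteq> y \<and> f x = w \<and> f y = w"
      using f(2) by (simp add: \<tau>_def)
    then show "\<exists>x y. x \<noteq> y \<and> f x = w \<and> f y = w" by blast
  qed
  moreover have "\<forall>x. sees R f (at x) (f x)" using f(1) by (simp add: fills_def)
  ultimately show ?thesis by (intro exI[of _ f] conjI ballI)
qed

end

section \<open>The canonical model and its filtration\<close>

text \<open>Maximal consistent sets, described as the sets of formulas true under Boolean valuations
  that verify \<open>L\<close>; deciding negations is the last clause with falsity for
  \<open>B\<close>.\<close>

definition world :: "fm set \<Rightarrow> fm set \<Rightarrow> bool" where
  "world L x \<longleftrightarrow> L \<subseteq> x \<and> \<^bold>\<bottom> \<notin> x \<and> (\<forall>A B. A \<^bold>\<rightarrow> B \<in> x \<longleftrightarrow> (A \<in> x \<longrightarrow> B \<in> x))"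

definition derives :: "fm set \<Rightarrow> fm set \<Rightarrow> fm \<Rightarrow> bool" where
  "derives L \<Gamma> A \<longleftrightarrow> (\<exists>xs. set xs \<subseteq> \<Gamma> \<and> foldr Imp xs A \<in> L)"

lemma world_Imp: "world L x \<Longrightarrow> A \<^bold>\<rightarrow> B \<in> x \<longleftrightarrow> (A \<in> x \<longrightarrow> B \<in> x)"
  and world_Bot: "world L x \<Longrightarrow> \<^bold>\<bottom> \<notin> x"
  and world_sub: "world L x \<Longrightarrow> A \<in> L \<Longrightarrow> A \<in> x"
  by (auto simp: world_def)

lemmas world_simps = world_Imp world_Bot

lemma world_eqI:
  assumes "world L x" "world L y" "x \<subseteq> y"
  shows "x = y"
proof -
  have "A \<in> x" if "A \<in> y" for A
  proof (rule ccontr)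
    assume "A \<notin> x"
    then have "\<^bold>\<not> A \<in> y" using assms world_Imp[OF assms(1)] by blast
    then show False using that assms(2) by (simp add: world_simps)
  qed
  then show ?thesis using assms(3) by blast
qed

lemma normal_logicD:
  assumes "normal_logic L"
  shows "tautology A \<Longrightarrow> A \<in> L"
    and "A \<^bold>\<rightarrow> B \<in> L \<Longrightarrow> A \<in> L \<Longrightarrow> B \<in> L"
    and "A \<in> L \<Longrightarrow> \<box> A \<in> L"
    and "A \<in> L \<Longrightarrow> [\<noteq>] A \<in> L"
    and "A \<in> L \<Longrightarrow> subst s A \<in> L"
  using assms unfolding normal_logic_def by blast+

lemma normal_logic_K:
  assumes "normal_logic L"
  shows "\<box> (A \<^bold>\<rightarrow> B) \<^bold>\<rightarrow> (\<box> A \<^bold>\<rightarrow> \<box> B) \<in> L"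
    and "[\<noteq>] (A \<^bold>\<rightarrow> B) \<^bold>\<rightarrow> ([\<noteq>] A \<^bold>\<rightarrow> [\<noteq>] B) \<in> L"
proof -
  let ?s = "\<lambda>i. if i = 0 then A else B"
  have ax: "\<box> (Var 0 \<^bold>\<rightarrow> Var 1) \<^bold>\<rightarrow> (\<box> Var 0 \<^bold>\<rightarrow> \<box> Var 1) \<in> L"
    "[\<noteq>] (Var 0 \<^bold>\<rightarrow> Var 1) \<^bold>\<rightarrow> ([\<noteq>] Var 0 \<^bold>\<rightarrow> [\<noteq>] Var 1) \<in> L"
    using assms unfolding normal_logic_def by blast+
  show "\<box> (A \<^bold>\<rightarrow> B) \<^bold>\<rightarrow> (\<box> A \<^bold>\<rightarrow> \<box> B) \<in> L"
    using normal_logicD(5)[OF assms ax(1), of ?s] by simp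
  show "[\<noteq>] (A \<^bold>\<rightarrow> B) \<^bold>\<rightarrow> ([\<noteq>] A \<^bold>\<rightarrow> [\<noteq>] B) \<in> L"
    using normal_logicD(5)[OF assms ax(2), of ?s] by simp
qed

lemma prop_val_foldr:
  assumes "\<And>B C. v (B \<^bold>\<rightarrow> C) \<longleftrightarrow> (v B \<longrightarrow> v C)"
  shows "v (foldr Imp xs A) \<longleftrightarrow> ((\<forall>B\<in>set xs. v B) \<longrightarrow> v A)"
  by (induction xs) (auto simp: assms)

text \<open>Zorn's lemma for sets that do not derive \<open>A\<close>; derivations are finite, so
  unions of chains qualify. A maximal such set contains what it derives and decides implications,
  since otherwise derivations of \<open>A\<close> could be combined into one from the set
  itself.\<close>

lemma lindenbaum:
  assumes L: "normal_logic L" and "\<not> derives L \<Gamma> A"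
  shows "\<exists>x. world L x \<and> \<Gamma> \<subseteq> x \<and> A \<notin> x"
proof -
  note taut = normal_logicD(1)[OF L] and mp = normal_logicD(2)[OF L]
  define \<C> where "\<C> = {\<Delta>. \<Gamma> \<subseteq> \<Delta> \<and> \<not> derives L \<Delta> A}"
  have "\<Union>\<D> \<in> \<C>" if \<D>: "\<D> \<noteq> {}" "subset.chain \<C> \<D>" for \<D>
  proof -
    have DC: "\<D> \<subseteq> \<C>" using \<D>(2) by (simp add: subset.chain_def)
    have "\<not> derives L (\<Union>\<D>) A"
    proof
      assume "derives L (\<Union>\<D>) A"
      then obtain xs where xs: "set xs \<subseteq> \<Union>\<D>" "foldr Imp xs A \<in> L" by (auto simp: derives_def)
      obtain \<Delta> where "\<Delta> \<in> \<D>" "set xs \<subseteq> \<Delta>"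
        using finite_subset_Union_chain[OF _ xs(1) \<D>] by auto
      then show False using xs DC by (auto simp: \<C>_def derives_def)
    qed
    moreover have "\<Gamma> \<subseteq> \<Union>\<D>" using \<D>(1) DC by (auto simp: \<C>_def)
    ultimately show ?thesis by (simp add: \<C>_def)
  qed
  moreover have "\<C> \<noteq> {}" using assms by (auto simp: \<C>_def)
  ultimately obtain M where M: "M \<in> \<C>" "\<And>Y. Y \<in> \<C> \<Longrightarrow> M \<subseteq> Y \<Longrightarrow> Y = M"
    using subset_Zorn_nonempty[of \<C>] by metis
  have ndM: "\<not> derives L M A" using M(1) by (simp add: \<C>_def)
  have ins: "derives L (insert B M) A" if "B \<notin> M" for B
  proof (rule ccontr)
    assume "\<not> derives L (insert B M) A"
    then have "insert B M \<in> \<C>" using M(1) by (auto simp: \<C>_def)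
    then show False using M(2)[of "insert B M"] that by blast
  qed
  have closed: "B \<in> M" if "set xs \<subseteq> M" "foldr Imp xs B \<in> L" for xs B
  proof (rule ccontr)
    assume "B \<notin> M"
    then obtain ys where ys: "set ys \<subseteq> insert B M" "foldr Imp ys A \<in> L"
      using ins by (auto simp: derives_def)
    \<comment> \<open>Cut: the uses of \<open>B\<close> in \<open>ys\<close> are replaced by the
      premises \<open>xs\<close> of \<open>B\<close>.\<close>
    let ?zs = "xs @ filter (\<lambda>C. C \<noteq> B) ys"
    have "tautology (foldr Imp xs B \<^bold>\<rightarrow> foldr Imp ys A \<^bold>\<rightarrow> foldr Imp ?zs A)"
      unfolding tautology_def by (auto simp: prop_val_foldr simp del: foldr_append)
    then have "foldr Imp ?zs A \<in> L" using taut mp that(2) ys(2) by blast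
    moreover have "set ?zs \<subseteq> M" using that(1) ys(1) by auto
    ultimately show False using ndM unfolding derives_def by blast
  qed
  have "world L M"
    unfolding world_def
  proof (intro conjI allI iffI impI)
    show "L \<subseteq> M" using closed[of "[]"] by auto
    show "\<^bold>\<bottom> \<notin> M"
    proof
      assume "\<^bold>\<bottom> \<in> M"
      moreover have "foldr Imp [\<^bold>\<bottom>] A \<in> L" by (rule taut) (simp add: tautology_def)
      ultimately have "derives L M A" unfolding derives_def by (intro exI[of _ "[\<^bold>\<bottom>]"]) simp
      then show False using ndM by simp
    qed
  next
    fix B C assume "B \<^bold>\<rightarrow> C \<in> M" "B \<in> M"
    moreover have "foldr Imp [B \<^bold>\<rightarrow> C, B] C \<in> L" by (rule taut) (simp add: tautology_def)
    ultimately show "C \<in> M" using closed[of "[B \<^bold>\<rightarrow> C, B]"] by simp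
  next
    fix B C assume BC: "B \<in> M \<longrightarrow> C \<in> M"
    show "B \<^bold>\<rightarrow> C \<in> M"
    proof (cases "C \<in> M")
      case True
      have "foldr Imp [C] (B \<^bold>\<rightarrow> C) \<in> L" by (rule taut) (simp add: tautology_def)
      then show ?thesis using closed[of "[C]"] True by simp
    next
      case False
      then have "B \<notin> M" using BC by blast
      then obtain ys where ys: "set ys \<subseteq> insert B M" "foldr Imp ys A \<in> L"
        using ins by (auto simp: derives_def)
      show ?thesis
      proof (rule ccontr)
        assume "B \<^bold>\<rightarrow> C \<notin> M"
        then obtain zs where zs: "set zs \<subseteq> insert (B \<^bold>\<rightarrow> C) M" "foldr Imp zs A \<in> L"
          using ins by (auto simp: derives_def)
        \<comment> \<open>Every valuation verifies \<open>B\<close> or \<open>Imp B C\<close>. If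
          adding either yields \<open>A\<close>, then \<open>A\<close> follows from the other
          premises alone.\<close>
        let ?us = "filter (\<lambda>D. D \<noteq> B) ys @ filter (\<lambda>D. D \<noteq> B \<^bold>\<rightarrow> C) zs"
        have "tautology (foldr Imp ys A \<^bold>\<rightarrow> foldr Imp zs A \<^bold>\<rightarrow> foldr Imp ?us A)"
          unfolding tautology_def
        proof (intro allI impI)
          fix v :: "fm \<Rightarrow> bool"
          assume v: "\<not> v \<^bold>\<bottom> \<and> (\<forall>B C. v (B \<^bold>\<rightarrow> C) \<longleftrightarrow> (v B \<longrightarrow> v C))"
          have "(\<forall>D\<in>set ys. v D) \<or> (\<forall>D\<in>set zs. v D)" if "\<forall>D\<in>set ?us. v D"
            using that v by (cases "v B") auto
          then show "v (foldr Imp ys A \<^bold>\<rightarrow> foldr Imp zs A \<^bold>\<rightarrow> foldr Imp ?us A)"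
            using v by (simp add: prop_val_foldr del: foldr_append) blast
        qed
        then have "foldr Imp ?us A \<in> L" using taut mp ys(2) zs(2) by blast
        moreover have "set ?us \<subseteq> M" using ys(1) zs(1) by auto
        ultimately show False using ndM unfolding derives_def by blast
      qed
    qed
  qed
  moreover have "\<Gamma> \<subseteq> M" using M(1) by (simp add: \<C>_def)
  moreover have "A \<notin> M"
  proof
    assume "A \<in> M"
    moreover have "foldr Imp [A] A \<in> L" by (rule taut) (simp add: tautology_def)
    ultimately have "derives L M A" unfolding derives_def by (intro exI[of _ "[A]"]) simp
    then show False using ndM by simp
  qed
  ultimately show ?thesis by blast
qed

text \<open>Stated for a normal operator \<open>M\<close> to serve \<open>Box\<close> and
  \<open>DBox\<close> alike. The formulas boxed in \<open>x\<close> do not derive \<open>A\<close>,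
  since necessitation and K would put \<open>M A\<close> into \<open>x\<close>.\<close>

lemma modal_witness:
  assumes L: "normal_logic L" and x: "world L x" and "M A \<notin> x"
    and K: "\<And>A B. M (A \<^bold>\<rightarrow> B) \<^bold>\<rightarrow> (M A \<^bold>\<rightarrow> M B) \<in> L" and nec: "\<And>A. A \<in> L \<Longrightarrow> M A \<in> L"
  shows "\<exists>y. world L y \<and> (\<forall>B. M B \<in> x \<longrightarrow> B \<in> y) \<and> A \<notin> y"
proof -
  have dist: "M A \<in> x" if "M (foldr Imp xs A) \<in> x" "\<forall>B\<in>set xs. M B \<in> x" for xs
    using that
  proof (induction xs)
    case (Cons B xs)
    have "M (B \<^bold>\<rightarrow> foldr Imp xs A) \<^bold>\<rightarrow> (M B \<^bold>\<rightarrow> M (foldr Imp xs A)) \<in> x"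
      using K world_sub[OF x] by blast
    then show ?case using Cons by (simp add: world_Imp[OF x])
  qed simp
  have "\<not> derives L {B. M B \<in> x} A"
  proof
    assume "derives L {B. M B \<in> x} A"
    then obtain xs where "\<forall>B\<in>set xs. M B \<in> x" "foldr Imp xs A \<in> L" by (auto simp: derives_def)
    then show False using dist nec world_sub[OF x] assms(3) by blast
  qed
  from lindenbaum[OF L this] show ?thesis by blast
qed

primrec subfms :: "fm \<Rightarrow> fm set" where
  "subfms (Var i) = {Var i}"
| "subfms \<^bold>\<bottom> = {\<^bold>\<bottom>}"
| "subfms (A \<^bold>\<rightarrow> B) = insert (A \<^bold>\<rightarrow> B) (subfms A \<union> subfms B)"
| "subfms (\<box> A) = insert (\<box> A) (subfms A)"
| "subfms ([\<noteq>] A) = insert ([\<noteq>] A) (subfms A)"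

lemma finite_subfms: "finite (subfms A)"
  by (induction A) auto

lemma subfms_refl: "A \<in> subfms A"
  by (cases A) auto

lemma subfms_trans: "B \<in> subfms A \<Longrightarrow> subfms B \<subseteq> subfms A"
  by (induction A) auto

lemma subfms_closed:
  shows "B \<^bold>\<rightarrow> C \<in> subfms A \<Longrightarrow> B \<in> subfms A \<and> C \<in> subfms A"
    and "\<box> B \<in> subfms A \<Longrightarrow> B \<in> subfms A"
    and "[\<noteq>] B \<in> subfms A \<Longrightarrow> B \<in> subfms A"
  using subfms_trans subfms_refl by fastforce+

section \<open>The canonical relations and the generated submodel\<close>

locale DT1CK_world =
  fixes L :: "fm set" and x0 :: "fm set" and \<phi> :: fm
  assumes L: "normal_logic L"
    and axioms:
      "\<box> Var 0 \<^bold>\<rightarrow> \<box> \<box> Var 0 \<in> L"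
      "Var 0 \<^bold>\<and> [\<noteq>] Var 0 \<^bold>\<rightarrow> [\<noteq>] [\<noteq>] Var 0 \<in> L"
      "\<langle>\<noteq>\<rangle> [\<noteq>] Var 0 \<^bold>\<rightarrow> Var 0 \<in> L"
      "[\<noteq>] Var 0 \<^bold>\<rightarrow> \<box> Var 0 \<in> L"
      "[\<noteq>] Var 0 \<^bold>\<rightarrow> [\<noteq>] \<box> Var 0 \<in> L"
      "\<diamond> \<^bold>\<top> \<in> L" "Ku \<in> L" "AC_sharp_u \<in> L"
    and x0: "world L x0"
begin

lemma instances:
  assumes x: "world L x"
  shows "\<box> A \<^bold>\<rightarrow> \<box> \<box> A \<in> x"
    and "A \<^bold>\<and> [\<noteq>] A \<^bold>\<rightarrow> [\<noteq>] [\<noteq>] A \<in> x"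
    and "\<langle>\<noteq>\<rangle> [\<noteq>] A \<^bold>\<rightarrow> A \<in> x"
    and "[\<noteq>] A \<^bold>\<rightarrow> \<box> A \<in> x"
    and "[\<noteq>] A \<^bold>\<rightarrow> [\<noteq>] \<box> A \<in> x"
    and "\<diamond> \<^bold>\<top> \<in> x"
    and "\<box> (\<^bold>\<box> A \<^bold>\<or> \<^bold>\<box> \<^bold>\<not> A) \<^bold>\<rightarrow> (\<box> A \<^bold>\<or> \<box> \<^bold>\<not> A) \<in> x"
    and "[\<noteq>] (\<^bold>\<box> A \<^bold>\<or> \<^bold>\<box> \<^bold>\<not> A) \<^bold>\<and> (\<^bold>\<box> A \<^bold>\<or> \<^bold>\<box> \<^bold>\<not> A) \<^bold>\<rightarrow>
         ([\<noteq>] A \<^bold>\<and> A) \<^bold>\<or> ([\<noteq>] \<^bold>\<not> A \<^bold>\<and> \<^bold>\<not> A) \<in> x"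
  using axioms[THEN normal_logicD(5)[OF L, where s = "\<lambda>_. A"], THEN world_sub[OF x]]
  by (simp_all add: Ku_def AC_sharp_u_def)

definition RR :: "fm set \<Rightarrow> fm set \<Rightarrow> bool" where
  "RR x y \<longleftrightarrow> world L y \<and> (\<forall>A. \<box> A \<in> x \<longrightarrow> A \<in> y)"

definition DD :: "fm set \<Rightarrow> fm set \<Rightarrow> bool" where
  "DD x y \<longleftrightarrow> world L y \<and> (\<forall>A. [\<noteq>] A \<in> x \<longrightarrow> A \<in> y)"

lemma Box_iff: "world L x \<Longrightarrow> \<box> A \<in> x \<longleftrightarrow> (\<forall>y. RR x y \<longrightarrow> A \<in> y)"
  using modal_witness[OF L, of x Box A] normal_logic_K(1)[OF L] normal_logicD(3)[OF L]
  unfolding RR_def by blast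

lemma DBox_iff: "world L x \<Longrightarrow> [\<noteq>] A \<in> x \<longleftrightarrow> (\<forall>y. DD x y \<longrightarrow> A \<in> y)"
  using modal_witness[OF L, of x DBox A] normal_logic_K(2)[OF L] normal_logicD(4)[OF L]
  unfolding DD_def by blast

lemma RR_trans: "world L x \<Longrightarrow> RR x y \<Longrightarrow> RR y z \<Longrightarrow> RR x z"
  using instances(1)[of x] unfolding RR_def by (meson world_Imp)

lemma RR_DD: "world L x \<Longrightarrow> RR x y \<Longrightarrow> DD x y"
  using instances(4)[of x] unfolding RR_def DD_def by (meson world_Imp)

lemma DD_RR: "world L x \<Longrightarrow> DD x y \<Longrightarrow> RR y z \<Longrightarrow> DD x z"
  using instances(5)[of x] unfolding RR_def DD_def by (meson world_Imp)

lemma RR_serial: "world L x \<Longrightarrow> \<exists>y. RR x y"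
  using instances(6)[of x] Box_iff[of x "\<^bold>\<not> \<^bold>\<top>"] by (auto simp: world_simps)

lemma DD_sym:
  assumes "world L x" "DD x y"
  shows "DD y x"
  unfolding DD_def
proof (intro conjI allI impI)
  fix A assume A: "[\<noteq>] A \<in> y"
  have y: "world L y" using assms by (simp add: DD_def)
  have "[\<noteq>] \<^bold>\<not> [\<noteq>] A \<notin> x"
  proof
    assume "[\<noteq>] \<^bold>\<not> [\<noteq>] A \<in> x"
    then have "\<^bold>\<not> [\<noteq>] A \<in> y" using assms by (simp add: DD_def)
    then show False using A y by (simp add: world_simps)
  qed
  then show "A \<in> x" using instances(3)[OF assms(1), of A] assms(1) by (simp add: world_simps)
qed (rule assms(1))

text \<open>A formula \<open>B\<close> separating \<open>x\<close> from \<open>z\<close> strengthens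
  weak transitivity: if \<open>[\<noteq>] A\<close> holds at \<open>x\<close>, then \<open>A\<close>
  or \<open>B\<close> holds at \<open>x\<close> and at all its \<open>DD\<close>-successors, hence
  at \<open>z\<close>, where \<open>B\<close> fails.\<close>

lemma DD_pseudo_trans:
  assumes "world L x" "DD x y" "DD y z" "x \<noteq> z"
  shows "DD x z"
proof -
  have z: "world L z" using assms by (simp add: DD_def)
  then obtain B where B: "B \<in> x" "B \<notin> z" using world_eqI[OF assms(1) z] assms(4) by blast
  have "A \<in> z" if A: "[\<noteq>] A \<in> x" for A
  proof -
    have "[\<noteq>] (A \<^bold>\<or> B) \<in> x"
      using A unfolding DBox_iff[OF assms(1)] by (auto simp: DD_def world_simps)
    then have "[\<noteq>] [\<noteq>] (A \<^bold>\<or> B) \<in> x"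
      using instances(2)[OF assms(1), of "A \<^bold>\<or> B"] B assms(1) by (simp add: world_simps)
    then have "A \<^bold>\<or> B \<in> z" using assms(2,3) by (simp add: DD_def)
    then show ?thesis using B z by (simp add: world_simps)
  qed
  then show ?thesis using z by (simp add: DD_def)
qed

text \<open>One \<open>DD\<close>-step suffices to generate the submodel, by pseudo-transitivity;
  distinct points in it are always \<open>DD\<close>-related (\<open>DD_neq\<close>).\<close>

definition X :: "fm set set" where
  "X = {x. world L x \<and> (x = x0 \<or> DD x0 x)}"

lemma X_world: "x \<in> X \<Longrightarrow> world L x" by (simp add: X_def)

lemma X_Neg: "x \<in> X \<Longrightarrow> \<^bold>\<not> A \<in> x \<longleftrightarrow> A \<notin> x"
  using X_world[of x] by (simp add: world_simps)

lemma x0_X: "x0 \<in> X" using x0 by (simp add: X_def)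

lemma X_DD: "x \<in> X \<Longrightarrow> DD x y \<Longrightarrow> y \<in> X"
  using DD_pseudo_trans[OF x0, of x y] unfolding X_def DD_def by blast

lemma X_RR: "x \<in> X \<Longrightarrow> RR x y \<Longrightarrow> y \<in> X"
  using X_DD RR_DD X_world by blast

lemma DD_neq: "x \<in> X \<Longrightarrow> y \<in> X \<Longrightarrow> x \<noteq> y \<Longrightarrow> DD x y"
  using DD_sym[OF x0, of x] DD_pseudo_trans[of x x0 y] unfolding X_def by blast

text \<open>If \<open>x\<close> and \<open>y\<close> differ, go from \<open>x\<close> to
  \<open>y\<close> by \<open>DD\<close> and back by \<open>RR\<close>; otherwise \<open>RR\<close>
  is contained in \<open>DD\<close>. This keeps classes with predecessors out of
  \<open>N\<close>.\<close>

lemma RR_imp_DD_refl: "y \<in> X \<Longrightarrow> RR y x \<Longrightarrow> DD x x"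
  by (metis DD_RR DD_neq RR_DD X_RR X_world)

section \<open>Definable properties of points\<close>

text \<open>\<open>Ku\<close> and \<open>AC_sharp_u\<close> speak about formulas, so they can be
  applied to a property of points once a formula expresses it on \<open>X\<close>.\<close>

definition dfn :: "(fm set \<Rightarrow> bool) \<Rightarrow> bool" where
  "dfn P \<longleftrightarrow> (\<exists>A. \<forall>x\<in>X. P x \<longleftrightarrow> A \<in> x)"

lemma dfn_mem: "dfn (\<lambda>x. A \<in> x)"
  by (auto simp: dfn_def)

lemma dfn_imp:
  assumes "dfn P" "dfn Q"
  shows "dfn (\<lambda>x. P x \<longrightarrow> Q x)"
proof -
  obtain A B where "\<forall>x\<in>X. P x \<longleftrightarrow> A \<in> x" "\<forall>x\<in>X. Q x \<longleftrightarrow> B \<in> x"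
    using assms by (auto simp: dfn_def)
  then show ?thesis unfolding dfn_def
    by (intro exI[of _ "A \<^bold>\<rightarrow> B"]) (auto simp: world_Imp[OF X_world])
qed

lemma dfn_False: "dfn (\<lambda>x. False)"
  unfolding dfn_def using world_Bot[OF X_world] by blast

lemma dfn_not: "dfn P \<Longrightarrow> dfn (\<lambda>x. \<not> P x)"
  using dfn_imp[OF _ dfn_False] by simp

lemma dfn_const: "dfn (\<lambda>x. c)"
  using dfn_False dfn_not[OF dfn_False] by (cases c) auto

lemma dfn_conj: "dfn P \<Longrightarrow> dfn Q \<Longrightarrow> dfn (\<lambda>x. P x \<and> Q x)"
  using dfn_not[OF dfn_imp[OF _ dfn_not]] by simp

lemma dfn_box:
  assumes "dfn P"
  shows "dfn (\<lambda>x. \<forall>y. RR x y \<longrightarrow> P y)"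
proof -
  obtain A where A: "\<And>x. x \<in> X \<Longrightarrow> P x \<longleftrightarrow> A \<in> x" using assms by (auto simp: dfn_def)
  have "(\<forall>y. RR x y \<longrightarrow> P y) \<longleftrightarrow> \<box> A \<in> x" if "x \<in> X" for x
    unfolding Box_iff[OF X_world[OF that]] using A X_RR[OF that] by simp
  then show ?thesis unfolding dfn_def by blast
qed

text \<open>Case distinction on one \<open>Q i\<close> at a time. It makes arbitrary sets of
  filtration classes definable (\<open>dfn_et\<close>).\<close>

lemma dfn_finite:
  assumes "finite I" "\<And>i. i \<in> I \<Longrightarrow> dfn (Q i)" "\<And>S. dfn (P S)"
  shows "dfn (\<lambda>x. P {i \<in> I. Q i x} x)"
  using assms
proof (induction I arbitrary: P rule: finite_induct)
  case (insert i I)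
  have Q: "dfn (Q j)" if "j \<in> insert i I" for j using insert.prems(1) that .
  have "dfn (\<lambda>x. (Q i x \<longrightarrow> P (insert i S) x) \<and> (\<not> Q i x \<longrightarrow> P S x))" for S
    by (rule dfn_conj[OF dfn_imp[OF Q insert.prems(2)] dfn_imp[OF dfn_not[OF Q] insert.prems(2)]])
      simp_all
  then have "dfn (\<lambda>x. (Q i x \<longrightarrow> P (insert i {j \<in> I. Q j x}) x) \<and>
      (\<not> Q i x \<longrightarrow> P {j \<in> I. Q j x} x))"
    by (rule insert.IH[of "\<lambda>S x. (Q i x \<longrightarrow> P (insert i S) x) \<and> (\<not> Q i x \<longrightarrow> P S x)", rotated])
      (simp add: Q)
  moreover have "{j \<in> insert i I. Q j x} =
      (if Q i x then insert i {j \<in> I. Q j x} else {j \<in> I. Q j x})" for x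
    by auto
  ultimately show ?case by simp
qed simp

text \<open>Reads \<open>Ku\<close> as connectedness of the canonical cone of \<open>x\<close> with
  respect to definable properties.\<close>

lemma dfn_Ku:
  assumes x: "x \<in> X" and "dfn P"
    and P: "\<And>y z. RR x y \<Longrightarrow> RR y z \<Longrightarrow> P y \<longleftrightarrow> P z"
  shows "(\<forall>y. RR x y \<longrightarrow> P y) \<or> (\<forall>y. RR x y \<longrightarrow> \<not> P y)"
proof -
  obtain A where A: "\<And>x. x \<in> X \<Longrightarrow> P x \<longleftrightarrow> A \<in> x" using assms(2) by (auto simp: dfn_def)
  have "\<^bold>\<box> A \<^bold>\<or> \<^bold>\<box> \<^bold>\<not> A \<in> y" if y: "RR x y" for y
  proof -
    have yX: "y \<in> X" using X_RR x y by blast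
    note w = X_world[OF yX]
    have "A \<in> z \<longleftrightarrow> A \<in> y" if "RR y z" for z using P[OF y that] A yX X_RR[OF yX that] by simp
    moreover have "\<^bold>\<not> A \<in> z \<longleftrightarrow> A \<notin> z" if "RR y z" for z
      using that by (auto simp: RR_def world_simps)
    ultimately show ?thesis by (auto simp: world_simps[OF w] Box_iff[OF w])
  qed
  then have "\<box> A \<in> x \<or> \<box> \<^bold>\<not> A \<in> x"
    using instances(7)[OF X_world[OF x], of A]
    by (auto simp: world_simps[OF X_world[OF x]] Box_iff[OF X_world[OF x], of "Or _ _"])
  then show ?thesis
    unfolding Box_iff[OF X_world[OF x]] using A X_RR[OF x] X_Neg by metis
qed

text \<open>The same reading of \<open>AC_sharp_u\<close> for all of \<open>X\<close>, since a point
  and its \<open>DD\<close>-successors exhaust \<open>X\<close>.\<close>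

lemma dfn_AC:
  assumes "dfn P" and P: "\<And>y z. y \<in> X \<Longrightarrow> RR y z \<Longrightarrow> P y \<longleftrightarrow> P z" and xy: "x \<in> X" "y \<in> X"
  shows "P x \<longleftrightarrow> P y"
proof (cases "x = y")
  case False
  obtain A where A: "\<And>x. x \<in> X \<Longrightarrow> P x \<longleftrightarrow> A \<in> x" using assms(1) by (auto simp: dfn_def)
  note wx = X_world[OF xy(1)]
  have *: "\<^bold>\<box> A \<^bold>\<or> \<^bold>\<box> \<^bold>\<not> A \<in> y" if yX: "y \<in> X" for y
  proof -
    note w = X_world[OF yX]
    have "A \<in> z \<longleftrightarrow> A \<in> y" if "RR y z" for z using P[OF yX that] A yX X_RR[OF yX that] by simp
    moreover have "\<^bold>\<not> A \<in> z \<longleftrightarrow> A \<notin> z" if "RR y z" for z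
      using that by (auto simp: RR_def world_simps)
    ultimately show ?thesis by (auto simp: world_simps[OF w] Box_iff[OF w])
  qed
  have "[\<noteq>] (\<^bold>\<box> A \<^bold>\<or> \<^bold>\<box> \<^bold>\<not> A) \<in> x" using * X_DD[OF xy(1)] by (simp add: DBox_iff[OF wx])
  with *[OF xy(1)] instances(8)[OF wx, of A]
  have "([\<noteq>] A \<in> x \<and> A \<in> x) \<or> ([\<noteq>] \<^bold>\<not> A \<in> x \<and> A \<notin> x)"
    by (auto simp: world_simps[OF wx])
  moreover have "DD x y" using DD_neq xy False by blast
  ultimately have "A \<in> x \<longleftrightarrow> A \<in> y"
    unfolding DBox_iff[OF wx] using X_world[OF xy(2)] by (auto simp: world_simps)
  then show ?thesis using A xy by simp
qed simp

section \<open>Types and the filtration\<close>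

abbreviation Sg :: "fm set" where "Sg \<equiv> subfms \<phi>"

definition ty :: "fm set \<Rightarrow> fm set" where
  "ty x = {A \<in> Sg. A \<in> x}"

text \<open>\<open>T\<close> confines an entire cone above some successor of \<open>x\<close>. A
  minimal such \<open>T\<close> acts like a final cluster above \<open>x\<close>, described by types
  alone.\<close>

definition E :: "fm set set \<Rightarrow> fm set \<Rightarrow> bool" where
  "E T x \<longleftrightarrow> (\<exists>y. RR x y \<and> ty y \<in> T \<and> (\<forall>z. RR y z \<longrightarrow> ty z \<in> T))"

definition et :: "fm set \<Rightarrow> fm set \<times> fm set set set" where
  "et x = (ty x, {T \<in> Pow (Pow Sg). E T x})"

lemma dfn_ty: "dfn (\<lambda>x. P (ty x))"
  unfolding ty_def by (rule dfn_finite[OF finite_subfms dfn_mem dfn_const])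

lemma dfn_E: "dfn (E T)"
proof -
  have "dfn (\<lambda>x. \<not> (\<forall>y. RR x y \<longrightarrow> \<not> (ty y \<in> T \<and> (\<forall>z. RR y z \<longrightarrow> ty z \<in> T))))"
    by (intro dfn_not dfn_box dfn_conj dfn_ty)
  moreover have "E T = (\<lambda>x. \<not> (\<forall>y. RR x y \<longrightarrow> \<not> (ty y \<in> T \<and> (\<forall>z. RR y z \<longrightarrow> ty z \<in> T))))"
    by (rule ext) (auto simp: E_def)
  ultimately show ?thesis by simp
qed

lemma dfn_et: "dfn (\<lambda>x. P (et x))"
  unfolding et_def
  by (rule dfn_finite[where P = "\<lambda>S x. P (ty x, S)"])
    (auto simp: finite_subfms intro: dfn_E dfn_ty)

lemma finite_et: "finite (et ` X)"
proof (rule finite_subset)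
  show "et ` X \<subseteq> Pow Sg \<times> Pow (Pow (Pow Sg))" by (auto simp: et_def ty_def)
qed (simp add: finite_subfms)

lemma et_mem: "et x = et y \<Longrightarrow> A \<in> Sg \<Longrightarrow> A \<in> x \<longleftrightarrow> A \<in> y"
  by (auto simp: et_def ty_def)

text \<open>The formulas behind \<^const>\<open>E\<close> make any two points of a class see a common
  class: above a set \<^term>\<open>T\<close> of types that is minimal with \<^term>\<open>E T x1\<close>, the extended
  type of a point is determined by its type and \<^term>\<open>T\<close>.\<close>

lemma common_successor:
  assumes x1: "x1 \<in> X" and x2: "x2 \<in> X" and eq: "et x1 = et x2"
  shows "\<exists>z1 z2. RR x1 z1 \<and> RR x2 z2 \<and> et z1 = et z2"
proof -
  define \<T> where "\<T> = {T \<in> Pow (Pow Sg). E T x1}"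
  have \<T>2: "\<T> = {T \<in> Pow (Pow Sg). E T x2}" using eq by (simp add: \<T>_def et_def)
  obtain y where "RR x1 y" using RR_serial X_world x1 by blast
  then have "Pow Sg \<in> \<T>" by (auto simp: \<T>_def E_def ty_def)
  moreover have "finite \<T>" by (simp add: \<T>_def finite_subfms)
  ultimately obtain T where T: "T \<in> \<T>" "\<And>T'. T' \<in> \<T> \<Longrightarrow> T' \<subseteq> T \<Longrightarrow> T' = T"
    using finite_has_minimal[of \<T>] by (metis empty_iff)
  have TS: "T \<subseteq> Pow Sg" using T(1) by (simp add: \<T>_def)
  \<comment> \<open>The same \<open>T\<close> is minimal for both points, so one argument serves
    twice: above a suitable \<open>y\<close> all types in \<open>T\<close> occur, and the second
    component of \<open>et\<close> no longer varies.\<close>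
  have key: "\<exists>y. RR x y \<and> (\<forall>S\<in>T. \<exists>z. RR y z \<and> ty z = S) \<and>
      (\<forall>z. RR y z \<longrightarrow> (\<forall>T'. T' \<subseteq> Pow Sg \<longrightarrow> (E T' z \<longleftrightarrow> T \<subseteq> T')))"
    if x: "x \<in> X" and \<T>: "\<T> = {T \<in> Pow (Pow Sg). E T x}" for x
  proof -
    have wx: "world L x" using x X_world by blast
    have "E T x" using T(1) \<T> by simp
    then obtain y where y: "RR x y" "\<And>z. RR y z \<Longrightarrow> ty z \<in> T" by (auto simp: E_def)
    have wy: "world L y" using y by (simp add: RR_def)
    \<comment> \<open>The smaller confinement \<open>T \<inter> T'\<close> would be available from
      \<open>x\<close> already, against the minimality of \<open>T\<close>.\<close>
    have min: "T \<subseteq> T'" if "RR y z" "T' \<subseteq> Pow Sg" "ty z \<in> T'" "\<And>u. RR z u \<Longrightarrow> ty u \<in> T'" for z T'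
    proof -
      have "RR x z" using RR_trans wx y(1) that(1) by blast
      then have "E (T \<inter> T') x"
        unfolding E_def using that y(2) RR_trans[OF wy that(1)] by blast
      then have "T \<inter> T' \<in> \<T>" using \<T> TS by auto
      then show ?thesis using T(2)[of "T \<inter> T'"] by blast
    qed
    have m1: "\<exists>z. RR y z \<and> ty z = S" if S: "S \<in> T" for S
    proof -
      obtain z where z: "RR y z" using RR_serial wy by blast
      \<comment> \<open>Minimality against the set of all types seen from \<open>y\<close>: every
        member of \<open>T\<close> is among them.\<close>
      have "T \<subseteq> {ty u | u. RR y u}"
        by (rule min[OF z]) (use z RR_trans[OF wy z] in \<open>auto simp: ty_def\<close>)
      then show ?thesis using S by blast
    qed
    have m2: "E T' z \<longleftrightarrow> T \<subseteq> T'" if z: "RR y z" and T': "T' \<subseteq> Pow Sg" for z T'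
    proof
      assume "E T' z"
      then obtain u where u: "RR z u" "ty u \<in> T'" "\<And>v. RR u v \<Longrightarrow> ty v \<in> T'"
        by (auto simp: E_def)
      then show "T \<subseteq> T'" using min[OF RR_trans[OF wy z u(1)] T'] by blast
    next
      assume sub: "T \<subseteq> T'"
      have wz: "world L z" using z by (simp add: RR_def)
      obtain u where u: "RR z u" using RR_serial wz by blast
      have yu: "RR y u" using RR_trans[OF wy z u] .
      have "ty u \<in> T'" using y(2)[OF yu] sub by blast
      moreover have "ty v \<in> T'" if "RR u v" for v
        using y(2)[OF RR_trans[OF wy yu that]] sub by blast
      ultimately show "E T' z" unfolding E_def using u by blast
    qed
    show ?thesis by (intro m1 m2 exI[of _ y] conjI ballI allI impI y(1))
  qed
  from key[OF x1 \<T>_def] obtain y1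
    where y1: "RR x1 y1" "\<forall>S\<in>T. \<exists>z. RR y1 z \<and> ty z = S"
      "\<forall>z. RR y1 z \<longrightarrow> (\<forall>T'. T' \<subseteq> Pow Sg \<longrightarrow> (E T' z \<longleftrightarrow> T \<subseteq> T'))"
    by (elim exE conjE) (rule that)
  from key[OF x2 \<T>2] obtain y2
    where y2: "RR x2 y2" "\<forall>S\<in>T. \<exists>z. RR y2 z \<and> ty z = S"
      "\<forall>z. RR y2 z \<longrightarrow> (\<forall>T'. T' \<subseteq> Pow Sg \<longrightarrow> (E T' z \<longleftrightarrow> T \<subseteq> T'))"
    by (elim exE conjE) (rule that)
  have "E T x1" using T(1) by (simp add: \<T>_def)
  then obtain S where "S \<in> T" by (auto simp: E_def)
  obtain z1 where z1: "RR y1 z1" "ty z1 = S" using bspec[OF y1(2) \<open>S \<in> T\<close>] by blast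
  obtain z2 where z2: "RR y2 z2" "ty z2 = S" using bspec[OF y2(2) \<open>S \<in> T\<close>] by blast
  have E_eq: "E T' z1 \<longleftrightarrow> E T' z2" if "T' \<subseteq> Pow Sg" for T'
    unfolding y1(3)[rule_format, OF z1(1) that] y2(3)[rule_format, OF z2(1) that] ..
  have "{T \<in> Pow (Pow Sg). E T z1} = {T \<in> Pow (Pow Sg). E T z2}"
    by (intro Collect_cong conj_cong refl E_eq) (rule PowD)
  then have "et z1 = et z2" using z1(2) z2(2) by (simp add: et_def)
  moreover have "RR x1 z1" by (rule RR_trans[OF X_world[OF x1] y1(1) z1(1)])
  moreover have "RR x2 z2" by (rule RR_trans[OF X_world[OF x2] y2(1) z2(1)])
  ultimately show ?thesis by blast
qed

text \<open>The minimal filtration. Its transitive closure is needed because successive links may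
  meet in different members of a class.\<close>

definition R0 :: "(fm set \<times> fm set set set) rel" where
  "R0 = {(et x, et y) | x y. x \<in> X \<and> RR x y}"

lemma et_RR: "x \<in> X \<Longrightarrow> RR x y \<Longrightarrow> (et x, et y) \<in> R0\<^sup>+"
  by (auto simp: R0_def)

lemma R0_cases:
  assumes "(w, v) \<in> R0\<^sup>+"
  shows "\<exists>x y. x \<in> X \<and> RR x y \<and> w = et x \<and> (v = et y \<or> (et y, v) \<in> R0\<^sup>+)"
proof (rule converse_tranclE[OF assms])
  assume "(w, v) \<in> R0"
  then show ?thesis by (auto simp: R0_def)
next
  fix z assume z: "(w, z) \<in> R0" "(z, v) \<in> R0\<^sup>+"
  then obtain x y where "x \<in> X" "RR x y" "w = et x" "z = et y" by (auto simp: R0_def)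
  then show ?thesis using z(2) by blast
qed

text \<open>By the axiom of transitivity \<open>\<box> A\<close> travels along the chain together
  with \<open>A\<close>; both are subformulas, so changing representatives between links does no
  harm.\<close>

lemma R0_Box:
  assumes "(w, v) \<in> R0\<^sup>+" "\<box> A \<in> Sg" "w = et x" "x \<in> X" "v = et y" "y \<in> X" "\<box> A \<in> x"
  shows "A \<in> y"
proof -
  have A: "A \<in> Sg" using assms(2) subfms_closed by blast
  define Q where "Q u \<longleftrightarrow> (\<forall>y. u = et y \<longrightarrow> A \<in> y \<and> \<box> A \<in> y)" for u
  have step: "Q v" if uv: "(u, v) \<in> R0" and u: "\<forall>x. u = et x \<longrightarrow> \<box> A \<in> x" for u v
  proof -
    obtain x' y' where x'y': "x' \<in> X" "RR x' y'" "u = et x'" "v = et y'"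
      using uv by (auto simp: R0_def)
    then have "\<box> A \<in> x'" using u by blast
    moreover from this have "\<box> \<box> A \<in> x'"
      using instances(1)[OF X_world[OF x'y'(1)], of A] by (simp add: world_Imp[OF X_world[OF x'y'(1)]])
    ultimately have "A \<in> y'" "\<box> A \<in> y'" using x'y'(2) by (auto simp: RR_def)
    moreover have "B \<in> y' \<longleftrightarrow> B \<in> y" if "v = et y" "B \<in> Sg" for y B
      using et_mem[of y' y B] x'y'(4) that by simp
    ultimately show ?thesis unfolding Q_def using A assms(2) by blast
  qed
  have first: "\<forall>x'. w = et x' \<longrightarrow> \<box> A \<in> x'"
  proof (intro allI impI)
    fix x' assume "w = et x'"
    then have "et x = et x'" using assms(3) by simp
    from et_mem[OF this assms(2)] show "\<box> A \<in> x'" using assms(7) by blast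
  qed
  have "Q v" using assms(1)
  proof (induction rule: trancl_induct)
    fix u assume "(w, u) \<in> R0"
    then show "Q u" using first by (rule step)
  next
    fix u u' assume "(u, u') \<in> R0" "Q u"
    moreover from this(2) have "\<forall>x. u = et x \<longrightarrow> \<box> A \<in> x" unfolding Q_def by blast
    ultimately show "Q u'" by (intro step[of u u'])
  qed
  then show ?thesis using assms(5) unfolding Q_def by blast
qed

lemma closed_RR:
  assumes "A \<subseteq> S" "R0\<^sup>+ `` A \<subseteq> A" "R0\<^sup>+ `` (S - A) \<subseteq> S - A" "x \<in> X" "RR x y" "et x \<in> S"
  shows "et x \<in> A \<longleftrightarrow> et y \<in> A"
  using assms et_RR[OF assms(4,5)] by blast

lemma kframe_et: "kframe (et ` X) (R0\<^sup>+)"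
proof
  show "finite (et ` X)" by (rule finite_et)
  show sub: "R0\<^sup>+ \<subseteq> et ` X \<times> et ` X"
    by (rule trancl_subset_Sigma) (auto simp: R0_def intro: X_RR)
  show "trans (R0\<^sup>+)" by simp
  show "R0\<^sup>+ `` {w} \<noteq> {}" if w: "w \<in> et ` X" for w
  proof -
    obtain x where x: "x \<in> X" "w = et x" using w by blast
    then obtain y where "RR x y" using RR_serial X_world by blast
    then show ?thesis using et_RR[OF x(1)] x(2) by blast
  qed
  show "rconn (R0\<^sup>+) (R0\<^sup>+ `` {w})" if "w \<in> et ` X" for w
    unfolding rconn_def
  proof (intro allI impI)
    let ?S = "R0\<^sup>+ `` {w}"
    fix A assume A: "A \<subseteq> ?S" "A \<noteq> {}" "R0\<^sup>+ `` A \<subseteq> A" "R0\<^sup>+ `` (?S - A) \<subseteq> ?S - A"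
    \<comment> \<open>Any set of classes is definable, so \<open>Ku\<close> decides \<open>A\<close>
      on the cone of each representative of \<open>w\<close> separately.\<close>
    have const: "(\<forall>y. RR x y \<longrightarrow> et y \<in> A) \<or> (\<forall>y. RR x y \<longrightarrow> et y \<notin> A)"
      if x: "x \<in> X" "et x = w" for x
    proof (rule dfn_Ku[OF x(1) dfn_et])
      fix y z assume yz: "RR x y" "RR y z"
      have "et y \<in> ?S" using et_RR[OF x(1) yz(1)] x(2) by blast
      then show "et y \<in> A \<longleftrightarrow> et z \<in> A"
        using closed_RR[OF A(1,3,4) X_RR[OF x(1) yz(1)] yz(2)] by blast
    qed
    \<comment> \<open>A class seen from both representatives forces the two decisions to
      agree.\<close>
    have same: "et y1 \<in> A \<longleftrightarrow> et y2 \<in> A"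
      if h: "x1 \<in> X" "et x1 = w" "RR x1 y1" "x2 \<in> X" "et x2 = w" "RR x2 y2" for x1 x2 y1 y2
    proof -
      obtain z1 z2 where z: "RR x1 z1" "RR x2 z2" "et z1 = et z2"
        using common_successor[OF h(1,4)] h(2,5) by auto
      have "et y1 \<in> A \<longleftrightarrow> et z1 \<in> A" using const[OF h(1,2)] h(3) z(1) by blast
      moreover have "et y2 \<in> A \<longleftrightarrow> et z2 \<in> A" using const[OF h(4,5)] h(6) z(2) by blast
      ultimately show ?thesis using z(3) by simp
    qed
    \<comment> \<open>A class reached by a chain lies on the same side of \<open>A\<close> as the
      first link of the chain.\<close>
    have first: "\<exists>x y. x \<in> X \<and> et x = w \<and> RR x y \<and> (s \<in> A \<longleftrightarrow> et y \<in> A)" if s: "s \<in> ?S" for s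
    proof -
      obtain x y where xy: "x \<in> X" "RR x y" "w = et x" "s = et y \<or> (et y, s) \<in> R0\<^sup>+"
        using R0_cases[of w s] s by blast
      have "et y \<in> ?S" using et_RR[OF xy(1,2)] xy(3) by blast
      then have "s \<in> A \<longleftrightarrow> et y \<in> A" using xy(4) A(3,4) by blast
      then show ?thesis using xy by blast
    qed
    obtain a where a: "a \<in> A" using A(2) by blast
    have "s \<in> A" if s: "s \<in> ?S" for s
    proof -
      have "a \<in> ?S" using a A(1) by blast
      from first[OF this] obtain x1 y1
        where x1: "x1 \<in> X" "et x1 = w" "RR x1 y1" "et y1 \<in> A" using a by blast
      from first[OF s] obtain x2 y2
        where x2: "x2 \<in> X" "et x2 = w" "RR x2 y2" "s \<in> A \<longleftrightarrow> et y2 \<in> A" by blast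
      show ?thesis using same[OF x1(1-3) x2(1-3)] x1(4) x2(4) by blast
    qed
    then show "A = ?S" using A(1) by blast
  qed
qed

lemma rconn_et: "rconn (R0\<^sup>+) (et ` X)"
  unfolding rconn_def
proof (intro allI impI)
  fix A assume A: "A \<subseteq> et ` X" "A \<noteq> {}" "R0\<^sup>+ `` A \<subseteq> A" "R0\<^sup>+ `` (et ` X - A) \<subseteq> et ` X - A"
  obtain a where a: "a \<in> X" "et a \<in> A" using A(1,2) by blast
  have "et y \<in> A \<longleftrightarrow> et z \<in> A" if "y \<in> X" "RR y z" for y z
    using closed_RR[OF A(1,3,4) that] that by blast
  then have "et x \<in> A" if "x \<in> X" for x
    using dfn_AC[OF dfn_et, of "\<lambda>w. w \<in> A" a x] a that by blast
  then show "A = et ` X" using A(1) by blast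
qed

text \<open>Distinct points of \<open>X\<close> are \<open>DD\<close>-related, so such a class has
  one member, which is not \<open>DD\<close>-related to itself. These are the classes to be realised
  exactly once.\<close>

definition N :: "(fm set \<times> fm set set set) set" where
  "N = {w \<in> et ` X. \<forall>x y. x \<in> X \<longrightarrow> DD x y \<longrightarrow> et x = w \<longrightarrow> et y \<noteq> w}"

lemma N_no_pred: "R0\<^sup>+ `` (et ` X) \<inter> N = {}"
proof -
  have "w \<notin> N" if vw: "(v, w) \<in> R0\<^sup>+" for v w
  proof -
    obtain u where "(u, w) \<in> R0" using vw by (meson tranclE)
    then obtain x y where xy: "x \<in> X" "RR x y" "w = et y" by (auto simp: R0_def)
    then have "y \<in> X" "DD y y" using X_RR RR_imp_DD_refl by blast+
    then show ?thesis using xy by (auto simp: N_def)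
  qed
  then show ?thesis by blast
qed

text \<open>\<open>\<box>\<close> is matched by \<open>sees\<close>. For \<open>[\<noteq>]\<close>
  the number of preimages decides: a class may be visible from itself just when it is hit twice,
  that is, outside \<open>N\<close>.\<close>

lemma truth:
  fixes f :: "'a::topological_space \<Rightarrow> fm set \<times> fm set set set"
  assumes f: "range f = et ` X" "\<And>x. sees (R0\<^sup>+) f (at x) (f x)"
    "\<And>w. w \<in> et ` X \<Longrightarrow> (\<exists>x y. x \<noteq> y \<and> f x = w \<and> f y = w) \<longleftrightarrow> w \<notin> N"
    and "A \<in> Sg" "a \<in> X" "f x = et a"
  shows "dd_sat euclidean (\<lambda>i. {x. Var i \<in> fst (f x)}) x A \<longleftrightarrow> A \<in> a"
  using assms(4-)
proof (induction A arbitrary: x a)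
  case (Var i)
  then show ?case by (simp add: et_def ty_def)
next
  case Bot
  then show ?case using world_Bot[OF X_world] by simp
next
  case (Imp A B)
  then show ?case using subfms_closed(1)[OF Imp.prems(1)] world_Imp[OF X_world] by simp
next
  case (Box A)
  note IH = Box.IH[OF subfms_closed(2)[OF Box.prems(1)]]
  let ?sat = "\<lambda>y. dd_sat euclidean (\<lambda>i. {x. Var i \<in> fst (f x)}) y A"
  have "dd_sat euclidean (\<lambda>i. {x. Var i \<in> fst (f x)}) x (\<box> A) \<longleftrightarrow> (\<forall>\<^sub>F y in at x. ?sat y)"
    by (auto simp: eventually_at_topological)
  also have "\<dots> \<longleftrightarrow> \<box> A \<in> a"
  proof
    assume ev: "\<forall>\<^sub>F y in at x. ?sat y"
    have "A \<in> b" if b: "RR a b" for b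
    proof -
      have "\<exists>\<^sub>F y in at x. f y = et b"
        using f(2)[of x] et_RR[OF Box.prems(2) b] Box.prems(3) unfolding sees_def by metis
      then obtain y where "?sat y" "f y = et b"
        using frequently_eventually_conj[OF _ ev] frequently_ex by blast
      then show ?thesis using IH X_RR[OF Box.prems(2) b] by blast
    qed
    then show "\<box> A \<in> a" using Box_iff X_world Box.prems(2) by blast
  next
    assume a: "\<box> A \<in> a"
    have "\<forall>\<^sub>F y in at x. (f x, f y) \<in> R0\<^sup>+" using f(2)[of x] unfolding sees_def by blast
    then show "\<forall>\<^sub>F y in at x. ?sat y"
    proof (rule eventually_mono)
      fix y assume y: "(f x, f y) \<in> R0\<^sup>+"
      obtain b where b: "b \<in> X" "f y = et b" using f(1) by blast
      have "A \<in> b"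
        by (rule R0_Box[OF y Box.prems(1) Box.prems(3,2) b(2,1) a])
      then show "?sat y" using IH b by blast
    qed
  qed
  finally show ?case .
next
  case (DBox A)
  note A = subfms_closed(3)[OF DBox.prems(1)]
  note IH = DBox.IH[OF A]
  let ?sat = "\<lambda>y. dd_sat euclidean (\<lambda>i. {x. Var i \<in> fst (f x)}) y A"
  have "(\<forall>y. y \<noteq> x \<longrightarrow> ?sat y) \<longleftrightarrow> [\<noteq>] A \<in> a"
  proof
    assume all: "\<forall>y. y \<noteq> x \<longrightarrow> ?sat y"
    have "A \<in> b" if b: "DD a b" for b
    proof -
      have bX: "b \<in> X" using X_DD DBox.prems(2) b by blast
      have "\<exists>y. y \<noteq> x \<and> f y = et b"
      proof (cases "et a = et b")
        case True
        then have "et a \<notin> N" using b DBox.prems(2) by (auto simp: N_def)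
        then obtain y1 y2 where "y1 \<noteq> y2" "f y1 = et a" "f y2 = et a"
          using f(3)[of "et a"] DBox.prems(2) by blast
        then show ?thesis using True by metis
      next
        case False
        then show ?thesis using f(1) bX DBox.prems(3) by (metis imageE image_eqI rangeI)
      qed
      then show ?thesis using all IH bX by blast
    qed
    then show "[\<noteq>] A \<in> a" using DBox_iff X_world DBox.prems(2) by blast
  next
    assume a: "[\<noteq>] A \<in> a"
    show "\<forall>y. y \<noteq> x \<longrightarrow> ?sat y"
    proof (intro allI impI)
      fix y assume "y \<noteq> x"
      obtain b where b: "b \<in> X" "f y = et b" using f(1) by blast
      have "A \<in> b"
      proof (cases "et a = et b")
        case True
        \<comment> \<open>The points \<open>a\<close> and \<open>b\<close> need not be
          \<open>DD\<close>-related, but some pair in their class is, and membership of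
          \<open>[\<noteq>] A\<close> and \<open>A\<close> is constant on the class.\<close>
        then have "et a \<notin> N" using f(3)[of "et a"] \<open>y \<noteq> x\<close> b DBox.prems by auto
        then obtain a' b' where ab: "a' \<in> X" "DD a' b'" "et a' = et a" "et b' = et a"
          using DBox.prems(2) by (auto simp: N_def)
        then have "[\<noteq>] A \<in> a'" using a et_mem[of a' a] DBox.prems(1) by blast
        then have "A \<in> b'" using ab(2) by (simp add: DD_def)
        then show ?thesis using et_mem[of b' b] ab(4) True A by simp
      next
        case False
        then have "DD a b" using DD_neq DBox.prems(2) b(1) by metis
        then show ?thesis using a by (simp add: DD_def)
      qed
      then show "?sat y" using IH b by blast
    qed
  qed
  then show ?case by (simp add: Ball_def)
qed

lemma refuted:
  assumes "\<phi> \<notin> x0"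
  shows "\<phi> \<notin> Ld_neq (euclidean :: 'a::euclidean_space topology)"
proof -
  interpret F: kframe "et ` X" "R0\<^sup>+" by (rule kframe_et)
  have "N \<subseteq> et ` X" by (auto simp: N_def)
  moreover have "et ` X \<noteq> {}" using x0_X by blast
  ultimately obtain f :: "'a \<Rightarrow> _" where f: "range f = et ` X" "\<forall>x. sees (R0\<^sup>+) f (at x) (f x)"
    "\<forall>w\<in>et ` X. (\<exists>x y. x \<noteq> y \<and> f x = w \<and> f y = w) \<longleftrightarrow> w \<notin> N"
    using F.frame_realization[OF _ rconn_et _ N_no_pred] by blast
  obtain x where "f x = et x0" using f(1) x0_X by (metis imageI imageE)
  then have "\<not> dd_sat euclidean (\<lambda>i. {x. Var i \<in> fst (f x)}) x \<phi>"
    using truth[of f \<phi> x0 x] f x0_X subfms_refl assms by blast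
  then show ?thesis unfolding Ld_neq_def by auto
qed

end

section \<open>Soundness\<close>

text \<open>The new valuation is cut down to \<open>topspace X\<close>, so that it is among those
  over which \<open>Ld_neq\<close> quantifies.\<close>

lemma dd_sat_subst:
  "x \<in> topspace X \<Longrightarrow>
    dd_sat X V x (subst s A) \<longleftrightarrow> dd_sat X (\<lambda>i. {y \<in> topspace X. dd_sat X V y (s i)}) x A"
proof (induction A arbitrary: x)
  case (Box A)
  have "dd_sat X V y (subst s A) \<longleftrightarrow> dd_sat X (\<lambda>i. {y \<in> topspace X. dd_sat X V y (s i)}) y A"
    if "openin X U" "y \<in> U" for U y
    using Box.IH that openin_subset by blast
  then show ?case by (auto 0 4)
qed auto

lemma normal_logic_Ld_neq: "normal_logic (Ld_neq X)"
  unfolding normal_logic_def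
proof (intro conjI)
  show "{A. tautology A} \<subseteq> Ld_neq X"
  proof
    fix A assume "A \<in> {A. tautology A}"
    then have "dd_sat X V x A" for V x
      unfolding tautology_def mem_Collect_eq by (elim allE[of _ "dd_sat X V x"]) simp
    then show "A \<in> Ld_neq X" by (simp add: Ld_neq_def)
  qed
  have "dd_sat X V x (\<box> (Var 0 \<^bold>\<rightarrow> Var 1) \<^bold>\<rightarrow> (\<box> Var 0 \<^bold>\<rightarrow> \<box> Var 1))" for V x
    unfolding dd_sat.simps
  proof (intro impI, elim exE conjE)
    fix U U'
    assume "openin X U" "x \<in> U" "\<forall>y\<in>U - {x}. y \<in> V 0 \<longrightarrow> y \<in> V 1"
      "openin X U'" "x \<in> U'" "\<forall>y\<in>U' - {x}. y \<in> V 0"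
    then show "\<exists>U. openin X U \<and> x \<in> U \<and> (\<forall>y\<in>U - {x}. y \<in> V 1)"
      by (intro exI[of _ "U \<inter> U'"]) auto
  qed
  then show "\<box> (Var 0 \<^bold>\<rightarrow> Var 1) \<^bold>\<rightarrow> (\<box> Var 0 \<^bold>\<rightarrow> \<box> Var 1) \<in> Ld_neq X"
    unfolding Ld_neq_def by blast
  show "[\<noteq>] (Var 0 \<^bold>\<rightarrow> Var 1) \<^bold>\<rightarrow> ([\<noteq>] Var 0 \<^bold>\<rightarrow> [\<noteq>] Var 1) \<in> Ld_neq X"
    by (simp add: Ld_neq_def)
  show "\<forall>A B. A \<^bold>\<rightarrow> B \<in> Ld_neq X \<longrightarrow> A \<in> Ld_neq X \<longrightarrow> B \<in> Ld_neq X"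
    unfolding Ld_neq_def by simp
  show "\<forall>A\<in>Ld_neq X. \<box> A \<in> Ld_neq X"
  proof
    fix A assume "A \<in> Ld_neq X"
    then have "dd_sat X V x (\<box> A)" if "\<forall>i. V i \<subseteq> topspace X" "x \<in> topspace X" for V x
      unfolding dd_sat.simps Ld_neq_def using that by (intro exI[of _ "topspace X"]) simp
    then show "\<box> A \<in> Ld_neq X" by (simp only: Ld_neq_def mem_Collect_eq) blast
  qed
  show "\<forall>A\<in>Ld_neq X. [\<noteq>] A \<in> Ld_neq X" by (simp add: Ld_neq_def)
  show "\<forall>A\<in>Ld_neq X. \<forall>s. subst s A \<in> Ld_neq X"
  proof (intro ballI allI)
    fix A s assume A: "A \<in> Ld_neq X"
    have "dd_sat X V x (subst s A)" if "x \<in> topspace X" for V x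
      unfolding dd_sat_subst[OF that] using A that by (simp add: Ld_neq_def)
    then show "subst s A \<in> Ld_neq X" by (simp add: Ld_neq_def)
  qed
qed

section \<open>Validity of the axioms\<close>

lemma dd_sat_Box_euclidean:
  "dd_sat euclidean V x (\<box> A) \<longleftrightarrow> (\<forall>\<^sub>F y in at x. dd_sat euclidean V y A)"
  by (auto simp: eventually_at_topological)

lemma dd_sat_DBox_euclidean:
  "dd_sat euclidean V x ([\<noteq>] A) \<longleftrightarrow> (\<forall>y. y \<noteq> x \<longrightarrow> dd_sat euclidean V y A)"
  by (simp add: Ball_def)

lemmas dd_sat_euclidean = dd_sat.simps(1-3) dd_sat_Box_euclidean dd_sat_DBox_euclidean

lemma euclidean_Ld_neqI:
  assumes "\<And>V (x :: 'a::topological_space). dd_sat euclidean V x A"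
  shows "A \<in> Ld_neq (euclidean :: 'a topology)"
  using assms by (simp add: Ld_neq_def)

lemma locally_constant_on_connected:
  fixes S :: "'a::topological_space set"
  assumes "connected S" and "\<And>y. y \<in> S \<Longrightarrow> \<exists>U. open U \<and> y \<in> U \<and> (\<forall>z\<in>U. P z \<longleftrightarrow> P y)"
    and "x \<in> S" "y \<in> S"
  shows "P x \<longleftrightarrow> P y"
proof -
  have "\<exists>T. openin (top_of_set S) T \<and> y \<in> T \<and> (\<forall>z\<in>T. P y = P z)" if y: "y \<in> S" for y
  proof -
    obtain U where U: "open U" "y \<in> U" "\<forall>z\<in>U. P z \<longleftrightarrow> P y" using assms(2)[OF y] by blast
    have "P y = P z" if "z \<in> S \<inter> U" for z using U(3) that by (metis IntD2)
    then show ?thesis using U(1,2) y by (intro exI[of _ "S \<inter> U"]) (simp add: openin_open_Int)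
  qed
  then show ?thesis
    by (intro connected_equivalence_relation[OF assms(1,3,4), of "\<lambda>a b. P a = P b"]) simp_all
qed

lemma RBox_locally_constant:
  assumes "dd_sat euclidean V y (\<^bold>\<box> Var i \<^bold>\<or> \<^bold>\<box> \<^bold>\<not> Var i)"
  shows "\<exists>U. open U \<and> y \<in> U \<and> (\<forall>z\<in>U. z \<in> V i \<longleftrightarrow> y \<in> V i)"
proof -
  have "\<exists>U. open U \<and> y \<in> U \<and> (\<forall>z\<in>U. z \<noteq> y \<longrightarrow> (z \<in> V i \<longleftrightarrow> y \<in> V i))"
    using assms unfolding dd_sat_euclidean eventually_at_topological by blast
  then show ?thesis by metis
qed

text \<open>The premise makes the variable locally constant on a punctured ball, which is connected
  because the dimension is at least two.\<close>

lemma Ku_valid: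
  assumes "2 \<le> DIM('a::euclidean_space)"
  shows "Ku \<in> Ld_neq (euclidean :: 'a topology)"
proof (rule euclidean_Ld_neqI)
  fix V :: "nat \<Rightarrow> 'a set" and x
  have "dd_sat euclidean V x (\<box> Var 0) \<or> dd_sat euclidean V x (\<box> \<^bold>\<not> Var 0)"
    if box: "dd_sat euclidean V x (\<box> (\<^bold>\<box> Var 0 \<^bold>\<or> \<^bold>\<box> \<^bold>\<not> Var 0))"
  proof -
    obtain U where U: "open U" "x \<in> U"
      "\<And>y. y \<in> U \<Longrightarrow> y \<noteq> x \<Longrightarrow> dd_sat euclidean V y (\<^bold>\<box> Var 0 \<^bold>\<or> \<^bold>\<box> \<^bold>\<not> Var 0)"
      using box unfolding dd_sat_Box_euclidean eventually_at_topological by blast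
    obtain r where r: "0 < r" "ball x r \<subseteq> U" using U(1,2) open_contains_ball by blast
    have lc: "\<exists>U. open U \<and> y \<in> U \<and> (\<forall>z\<in>U. z \<in> V 0 \<longleftrightarrow> y \<in> V 0)" if "y \<in> ball x r - {x}" for y
    proof (rule RBox_locally_constant, rule U(3))
      show "y \<in> U" "y \<noteq> x" using that r(2) by blast+
    qed
    note const = locally_constant_on_connected[OF connected_punctured_ball[OF assms] lc]
    have nhd: "\<forall>\<^sub>F y in at x. y \<in> ball x r - {x}"
      using r(1) by (auto simp: eventually_at_topological intro!: exI[of _ "ball x r"])
    show ?thesis
    proof (cases "\<exists>y\<in>ball x r - {x}. y \<in> V 0")
      case True
      then obtain z where "z \<in> ball x r - {x}" "z \<in> V 0" ..
      then have "\<And>y. y \<in> ball x r - {x} \<Longrightarrow> y \<in> V 0" using const by blast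
      with nhd have "\<forall>\<^sub>F y in at x. y \<in> V 0" by (rule eventually_mono)
      then show ?thesis by (simp only: dd_sat_euclidean simp_thms)
    next
      case False
      then have "\<And>y. y \<in> ball x r - {x} \<Longrightarrow> y \<notin> V 0" by blast
      with nhd have "\<forall>\<^sub>F y in at x. y \<notin> V 0" by (rule eventually_mono)
      then show ?thesis by (simp only: dd_sat_euclidean simp_thms)
    qed
  qed
  then show "dd_sat euclidean V x Ku"
    unfolding Ku_def dd_sat.simps(2,3) by blast
qed

text \<open>As for \<open>Ku\<close>, with the whole space in place of the punctured ball.\<close>

lemma AC_sharp_u_valid: "AC_sharp_u \<in> Ld_neq (euclidean :: 'a::euclidean_space topology)"
proof (rule euclidean_Ld_neqI)
  fix V :: "nat \<Rightarrow> 'a set" and x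
  let ?A = "\<^bold>\<box> Var 0 \<^bold>\<or> \<^bold>\<box> \<^bold>\<not> Var 0"
  have "(\<forall>y. y \<in> V 0) \<or> (\<forall>y. y \<notin> V 0)"
    if x: "dd_sat euclidean V x ([\<noteq>] ?A)" "dd_sat euclidean V x ?A"
  proof -
    have A: "dd_sat euclidean V y ?A" for y
      using x(1)[unfolded dd_sat_DBox_euclidean, rule_format, of y] x(2) by (cases "y = x") iprover+
    have "\<exists>U. open U \<and> y \<in> U \<and> (\<forall>z\<in>U. z \<in> V 0 \<longleftrightarrow> y \<in> V 0)" for y
      by (rule RBox_locally_constant[OF A])
    then have "y \<in> V 0 \<longleftrightarrow> z \<in> V 0" for y z
      by (intro locally_constant_on_connected[OF connected_UNIV]) simp_all
    then show ?thesis by blast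
  qed
  then show "dd_sat euclidean V x AC_sharp_u"
    unfolding AC_sharp_u_def dd_sat.simps(1-3) dd_sat_DBox_euclidean by blast
qed

text \<open>In a T1 space an open set remains open without \<open>x\<close>, so what holds near
  \<open>x\<close> but off \<open>x\<close> holds around each nearby point.\<close>

lemma eventually_at_eventually_at:
  fixes x :: "'a::t1_space"
  assumes "\<forall>\<^sub>F y in at x. P y"
  shows "\<forall>\<^sub>F y in at x. \<forall>\<^sub>F z in at y. P z"
proof -
  obtain U where U: "open U" "x \<in> U" "\<And>y. y \<in> U \<Longrightarrow> y \<noteq> x \<Longrightarrow> P y"
    using assms unfolding eventually_at_topological by blast
  have "\<forall>\<^sub>F z in at y. P z" if "y \<in> U" "y \<noteq> x" for y
    unfolding eventually_at_topological
  proof (intro exI[of _ "U - {x}"] conjI ballI impI)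
    show "open (U - {x})" "y \<in> U - {x}" using U(1) that by auto
    show "P z" if "z \<in> U - {x}" for z using U(3) that by blast
  qed
  then show ?thesis unfolding eventually_at_topological using U(1,2) by blast
qed

lemma eventually_at_T1:
  fixes x :: "'a::t1_space"
  assumes "\<forall>y. y \<noteq> x \<longrightarrow> P y"
  shows "\<forall>\<^sub>F z in at y. P z"
proof (cases "y = x")
  case True
  then show ?thesis unfolding eventually_at_topological
    using assms by (intro exI[of _ UNIV]) simp
next
  case False
  then show ?thesis unfolding eventually_at_topological
    using assms by (intro exI[of _ "- {x}"]) (simp add: open_Compl)
qed

lemma DT1_axioms_valid:
  fixes A :: fm
  assumes "A \<in> {\<box> Var 0 \<^bold>\<rightarrow> \<box> \<box> Var 0, Var 0 \<^bold>\<and> [\<noteq>] Var 0 \<^bold>\<rightarrow> [\<noteq>] [\<noteq>] Var 0,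
      \<langle>\<noteq>\<rangle> [\<noteq>] Var 0 \<^bold>\<rightarrow> Var 0, [\<noteq>] Var 0 \<^bold>\<rightarrow> \<box> Var 0, [\<noteq>] Var 0 \<^bold>\<rightarrow> [\<noteq>] \<box> Var 0, \<diamond> \<^bold>\<top>}"
  shows "A \<in> Ld_neq (euclidean :: 'a::{t1_space, perfect_space} topology)"
proof (rule euclidean_Ld_neqI)
  fix V :: "nat \<Rightarrow> 'a set" and x
  have "dd_sat euclidean V x (\<box> Var 0 \<^bold>\<rightarrow> \<box> \<box> Var 0)"
    unfolding dd_sat_euclidean by (intro impI eventually_at_eventually_at)
  moreover have "dd_sat euclidean V x (Var 0 \<^bold>\<and> [\<noteq>] Var 0 \<^bold>\<rightarrow> [\<noteq>] [\<noteq>] Var 0)"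
    unfolding dd_sat_euclidean by metis
  moreover have "dd_sat euclidean V x (\<langle>\<noteq>\<rangle> [\<noteq>] Var 0 \<^bold>\<rightarrow> Var 0)"
    unfolding dd_sat_euclidean by metis
  moreover have "dd_sat euclidean V x ([\<noteq>] Var 0 \<^bold>\<rightarrow> \<box> Var 0)"
    unfolding dd_sat_euclidean by (intro impI) (rule eventually_at_T1)
  moreover have "dd_sat euclidean V x ([\<noteq>] Var 0 \<^bold>\<rightarrow> [\<noteq>] \<box> Var 0)"
    unfolding dd_sat_euclidean by (intro impI allI) (rule eventually_at_T1)
  \<comment> \<open>No point is isolated, so \<open>at x\<close> is a proper filter.\<close>
  moreover have "dd_sat euclidean V x (\<diamond> \<^bold>\<top>)"
    unfolding dd_sat_euclidean by simp
  ultimately show "dd_sat euclidean V x A"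
    using assms unfolding insert_iff empty_iff by (elim disjE) (simp_all only:)
qed

theorem theorem11p5:
  assumes "CARD('n::finite) \<ge> 2"
  shows "Ld_neq (euclidean :: (real ^ 'n) topology) = DT1CK"
proof
  have dim: "2 \<le> DIM(real ^ 'n)" using assms by simp
  have "KT1 \<subseteq> Ld_neq (euclidean :: (real ^ 'n) topology)"
    unfolding KT1_def
    by (intro least_logic_least normal_logic_Ld_neq subsetI DT1_axioms_valid) blast
  moreover have "{\<diamond> \<^bold>\<top>} \<subseteq> Ld_neq (euclidean :: (real ^ 'n) topology)"
    by (intro subsetI DT1_axioms_valid) blast
  ultimately have "DT1 \<subseteq> Ld_neq (euclidean :: (real ^ 'n) topology)"
    unfolding DT1_def ext_logic_def by (intro least_logic_least normal_logic_Ld_neq Un_least)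
  then show "DT1CK \<subseteq> Ld_neq (euclidean :: (real ^ 'n) topology)"
    unfolding DT1CK_def ext_logic_def
    by (intro least_logic_least normal_logic_Ld_neq Un_least insert_subsetI empty_subsetI
        Ku_valid[OF dim] AC_sharp_u_valid)
next
  have L: "normal_logic DT1CK"
    unfolding DT1CK_def ext_logic_def by (rule normal_logic_least_logic)
  have sub1: "DT1 \<union> {Ku, AC_sharp_u} \<subseteq> DT1CK"
    unfolding DT1CK_def ext_logic_def by (rule least_logic_superset)
  have sub2: "KT1 \<union> {\<diamond> \<^bold>\<top>} \<subseteq> DT1"
    unfolding DT1_def ext_logic_def by (rule least_logic_superset)
  note sub3 = least_logic_superset[of "{\<box> Var 0 \<^bold>\<rightarrow> \<box> \<box> Var 0,
      Var 0 \<^bold>\<and> [\<noteq>] Var 0 \<^bold>\<rightarrow> [\<noteq>] [\<noteq>] Var 0, \<langle>\<noteq>\<rangle> [\<noteq>] Var 0 \<^bold>\<rightarrow> Var 0,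
      [\<noteq>] Var 0 \<^bold>\<rightarrow> \<box> Var 0, [\<noteq>] Var 0 \<^bold>\<rightarrow> [\<noteq>] \<box> Var 0}", folded KT1_def]
  have KT1: "A \<in> KT1 \<Longrightarrow> A \<in> DT1CK" for A
    using sub1 sub2 by (meson UnI1 subsetD)
  note axs = sub3[unfolded insert_subset] sub2[unfolded Un_subset_iff insert_subset]
    sub1[unfolded Un_subset_iff insert_subset]
  show "Ld_neq (euclidean :: (real ^ 'n) topology) \<subseteq> DT1CK"
  proof (rule ccontr)
    assume "\<not> Ld_neq (euclidean :: (real ^ 'n) topology) \<subseteq> DT1CK"
    then obtain \<phi> where \<phi>: "\<phi> \<in> Ld_neq (euclidean :: (real ^ 'n) topology)" "\<phi> \<notin> DT1CK" by blast
    \<comment> \<open>Only the empty list has its members in the empty set of premises.\<close>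
    then have "\<not> derives DT1CK {} \<phi>" by (simp add: derives_def)
    then obtain x0 where w0: "world DT1CK x0" "\<phi> \<notin> x0" using lindenbaum[OF L] by blast
    interpret DT1CK_world DT1CK x0 \<phi>
    proof
      show "\<diamond> \<^bold>\<top> \<in> DT1CK" using axs by (meson subsetD)
    qed (use L w0(1) axs in \<open>simp_all only: KT1\<close>)
    show False using refuted[OF w0(2)] \<phi>(1) by blast
  qed
qed

end
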